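(* Let $\mathbb{X}=(\mathbb{X}_{st})_{s,t\in\mathbb{R}}$ be a planarly branched rough path over the time-augmented path $(t,X^1_t,\dots,X^n_t)$ (so $\langle \mathbb{X}_{st},\bullet_0\rangle=t-s$), and assume that $$\langle \mathbb{X}_{st},\omega\triangleright\bullet_0\rangle=\int_s^t\langle \mathbb{X}_{su},\omega\rangle\,du\qquad\text{for all }\omega\in\mathcal{OF},\ s,t\in\mathbb{R}.$$ Let $\Pi$ and $\Gamma$ be the maps built from $\mathbb{X}$ as in the context. Then $(\Pi,\Gamma)$ is a model for $(A,\mathcal{PB},\mathcal{G})$.
   Context: All vector spaces are over $\mathbb{R}$. **Rough path side.** Fix $n$. A planar rooted tree is a finite rooted tree, edges directed away from the root, in which the outgoing edges of every vertex are linearly ordered from left to right. $\mathcal{PT}$ is the span of planar rooted trees with vertices decorated by $\{0,\dots,n\}$; $\bullet_i$ is the single-vertex tree decorated $i$. $\mathcal{OF}$ is the span of ordered forests (words of such trees, including the empty word $1$), graded by the number of vertices. For an ordered forest $\omega=\tau_1\cdots\tau_k$, $\omega\triangleright\bullet_0$ is the tree obtained by grafting $\tau_1,\dots,\tau_k$ in this order onto a root decorated $0$. Let $B_+(\omega)$ denote the tree obtained by grafting the trees of $\omega$ in order onto a new root, and $B_-$ removal of the root. A left admissible cut $c$ of a planar tree is a set of edges such that every path from the root to a leaf contains at most one edge of $c$, and whenever $e\in c$ every outgoing edge of the same vertex lying to the left of $e$ is in $c$. The trunk $T^c$ is the component of the root after removing $c$; the pruned part $P^c$ is obtained by concatenating,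 in planar order, the components cut off from the same vertex into a forest, and then taking the shuffle product of these forests over the different vertices. Put $\Delta_{MKW}(\omega)=\sum_{c}P^c(B_+(\omega))\otimes B_-(T^c(B_+(\omega)))$, the sum over left admissible cuts of $B_+(\omega)$. $\mathcal{H}_{MKW}=(\mathcal{OF},\sqcup\!\sqcup,\Delta_{MKW})$ is a commutative graded Hopf algebra, with $\sqcup\!\sqcup$ the shuffle product. A planarly branched rough path of regularity $\gamma\in(0,1]$ over the path $(X^0_t=t,X^1_t,\dots,X^n_t)$ is a family of linear forms $\mathbb{X}_{st}$ on $\mathcal{OF}$ with $\langle\mathbb{X}_{st},1\rangle=1$, $\langle\mathbb{X}_{st},x\sqcup\!\sqcup y\rangle=\langle\mathbb{X}_{st},x\rangle\langle\mathbb{X}_{st},y\rangle$, $\mathbb{X}_{su}\ast\mathbb{X}_{ut}=\mathbb{X}_{st}$ (where $\langle f\ast g,x\rangle=\langle f\otimes g,\Delta_{MKW}x\rangle$), $\sup_{s\neq t}|\langle\mathbb{X}_{st},x\rangle|/|t-s|^{\gamma|x|}<\infty$ for each forest $x$ with $|x|$ vertices, and $\langle\mathbb{X}_{st},\bullet_i\rangle=X^i_t-X^i_s$. **Regularity structure side.** $\mathcal{PB}$ is the span of planar rooted trees with undecorated vertices and edges decorated by $\{0,\dots,n\}$ (decoration $0$ is called "undecorated", the others "decorated"), such that every decorated edge ends in a leaf and each vertex has at most one decorated outgoing edge, which is then its rightmost outgoing edge. $\varphi:\mathcal{PT}\to\mathcal{PB}$ is the linear isomorphism which turns all edges of a tree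 into undecorated edges and replaces each vertex of decoration $i\neq0$ by an undecorated vertex with an additional rightmost outgoing edge of decoration $i$ ending in a leaf. It is extended to forests by applying it to each tree. On the regularity structure side, $B_+$ grafts an ordered forest, in order, onto a new root by undecorated edges and $B_-$ is its inverse. Thus $B_+\circ\varphi$ is a linear isomorphism from $\mathcal{OF}$ onto the span $\mathcal{PB}_+$ of trees in $\mathcal{PB}$ with no decorated edge adjacent to the root. The tree product on $\mathcal{PB}_+$ joins roots and shuffles the branches: $B_+(\varphi(\omega_1))\,B_+(\varphi(\omega_2))=B_+(\varphi(\omega_1\sqcup\!\sqcup\omega_2))$. Write $\bullet$ for the single-vertex tree in $\mathcal{PB}$. Let $\alpha_i$ be the regularity of $X^i$. The degree of a tree in $\mathcal{PB}$ is the sum over its edges, an edge decorated $i\ne0$ contributing $\alpha_i-1$ and an undecorated edge contributing $1$. $A$ is the set of degrees of trees in $\mathcal{PB}$, and $\mathcal{PB}$ is graded by degree. The coaction $\Delta^+:\mathcal{PB}\to\mathcal{PB}_+\otimes\mathcal{PB}$ is $\Delta^+(B_+(\varphi(\omega)))=(B_+\circ\varphi\otimes B_+\circ\varphi)\Delta_{MKW}(\omega)$ for $\omega\in\mathcal{OF}$, and, for a tree $\tau\in\mathcal{PB}$ with a decorated edge adjacent to the root, $\Delta^+(\tau)=(\mathrm{id}\otimes B_-)\bigl(\Delta^+(B_+(\tau))-B_+(\tau)\otimes\bullet\bigr)$. For a character $g$ of $\mathcal{PB}_+$ (for the tree product), $\Gamma_g=(g\otimes\mathrm{id})\Delta^+$,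 and $\mathcal{G}=\{\Gamma_g\}$. **The maps $\Pi$ and $\Gamma$.** $\Pi_s(B_+(\varphi(\omega)))(t)=\langle\mathbb{X}_{st},\omega\rangle$ for $\omega\in\mathcal{OF}$; for a tree $\tau$ with a decorated edge adjacent to the root, $\Pi_s(\tau)(t)=\frac{d}{dt}\Pi_s(B_+(\tau))(t)$ (derivative in the sense of distributions in $t$). Let $\gamma_{st}$ be the character of $\mathcal{PB}_+$ given by $\gamma_{st}(B_+(\varphi(\omega)))=\langle\mathbb{X}_{st},\omega\rangle$, and $\Gamma_{st}=(\gamma_{ts}\otimes\mathrm{id})\Delta^+$. **Model.** $(\Pi,\Gamma)$ is a model for $(A,\mathcal{PB},\mathcal{G})$ if $\Gamma_{xy}\in\mathcal{G}$, $\Gamma_{xx}=\mathrm{Id}$ and $\Gamma_{xy}\Gamma_{yz}=\Gamma_{xz}$ for all $x,y,z\in\mathbb{R}$, and the $\Pi_x:\mathcal{PB}\to\mathcal{S}'(\mathbb{R})$ are continuous linear maps with $\Pi_y=\Pi_x\Gamma_{xy}$ for all $x,y\in\mathbb{R}$. (No analytic bounds are required.) *)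

theory Defs
  imports "HOL-Analysis.Analysis" "HOL-Analysis.Finite_Function_Topology" "HOL-Library.Sublist"
begin

section \<open>Free vector spaces\<close>

text \<open>
  The span of a set of combinatorial objects, given as a type \<open>'a\<close>, is the type
  \<open>'a \<Rightarrow>\<^sub>0 real\<close> of finitely supported functions.  The tensor product of
  \<open>'a \<Rightarrow>\<^sub>0 real\<close> and \<open>'b \<Rightarrow>\<^sub>0 real\<close> is \<open>'a \<times> 'b \<Rightarrow>\<^sub>0 real\<close>.
\<close>

abbreviation basis :: "'a \<Rightarrow> ('a \<Rightarrow>\<^sub>0 real)" where
  "basis a \<equiv> Poly_Mapping.single a 1"

definition lin_ext :: "('a \<Rightarrow> 'v::real_vector) \<Rightarrow> ('a \<Rightarrow>\<^sub>0 real) \<Rightarrow> 'v" where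
  "lin_ext F x = (\<Sum>a\<in>Poly_Mapping.keys x. Poly_Mapping.lookup x a *\<^sub>R F a)"

definition bilin_ext ::
  "('a \<Rightarrow> 'b \<Rightarrow> 'v::real_vector) \<Rightarrow> ('a \<Rightarrow>\<^sub>0 real) \<Rightarrow> ('b \<Rightarrow>\<^sub>0 real) \<Rightarrow> 'v" where
  "bilin_ext F x y = lin_ext (\<lambda>a. lin_ext (F a) y) x"

definition lmap :: "('a \<Rightarrow> 'b) \<Rightarrow> ('a \<Rightarrow>\<^sub>0 real) \<Rightarrow> ('b \<Rightarrow>\<^sub>0 real)" where
  "lmap h = lin_ext (\<lambda>a. basis (h a))"

definition tensor :: "('a \<Rightarrow>\<^sub>0 real) \<Rightarrow> ('b \<Rightarrow>\<^sub>0 real) \<Rightarrow> ('a \<times> 'b \<Rightarrow>\<^sub>0 real)" where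
  "tensor = bilin_ext (\<lambda>a b. basis (a, b))"

text \<open>The linear map on the tensor product induced by a bilinear map.\<close>

definition tensor_lift ::
  "(('a \<Rightarrow>\<^sub>0 real) \<Rightarrow> ('b \<Rightarrow>\<^sub>0 real) \<Rightarrow> 'v::real_vector) \<Rightarrow> ('a \<times> 'b \<Rightarrow>\<^sub>0 real) \<Rightarrow> 'v" where
  "tensor_lift \<beta> = lin_ext (\<lambda>(a, b). \<beta> (basis a) (basis b))"

lemma lin_ext_basis [simp]: "lin_ext F (basis a) = F a"
  by (simp add: lin_ext_def)

lemma lmap_basis [simp]: "lmap h (basis a) = basis (h a)"
  by (simp add: lmap_def)


section \<open>Planar rooted trees and the Munthe-Kaas--Wright Hopf algebra\<close>

text \<open>
  Decorations are taken from a finite type \<open>'d\<close> with a distinguished element \<open>0\<close>, which plays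
  the role of the set \<open>{0,\<dots>,n}\<close> with \<open>n = CARD('d) - 1\<close>; the ordering of the decorations
  is never used.
\<close>

datatype 'd ptree = Node (dec: 'd) (branches: "'d ptree list")

type_synonym 'd forest = "'d ptree list"

primrec num_vertices :: "'d ptree \<Rightarrow> nat" where
  "num_vertices (Node i ts) = Suc (sum_list (map num_vertices ts))"

definition forest_size :: "'d forest \<Rightarrow> nat" where
  "forest_size \<omega> = sum_list (map num_vertices \<omega>)"

text \<open>The shuffle product on words, extended bilinearly (words count with multiplicity).\<close>

fun shuffle_words :: "'a list \<Rightarrow> 'a list \<Rightarrow> ('a list \<Rightarrow>\<^sub>0 real)" where
  "shuffle_words [] ys = basis ys"
| "shuffle_words (x # xs) [] = basis (x # xs)"
| "shuffle_words (x # xs) (y # ys) =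
     lmap ((#) x) (shuffle_words xs (y # ys)) + lmap ((#) y) (shuffle_words (x # xs) ys)"

definition shuffle :: "('a list \<Rightarrow>\<^sub>0 real) \<Rightarrow> ('a list \<Rightarrow>\<^sub>0 real) \<Rightarrow> ('a list \<Rightarrow>\<^sub>0 real)" where
  "shuffle = bilin_ext shuffle_words"

text \<open>
  A vertex is addressed by the list of branch indices (counted from \<open>0\<close> at the left) on the path
  from the root to it, an edge by the address of the vertex in which it ends.  So the edges on the
  path from the root to a vertex \<open>v\<close> are the nonempty prefixes of \<open>v\<close>, and the outgoing edges of
  \<open>v\<close> are, from left to right, \<open>v @ [0]\<close>, \<open>v @ [1]\<close>, \<open>\<dots>\<close>.
\<close>

primrec vertices :: "'d ptree \<Rightarrow> nat list set" where
  "vertices (Node i ts) = insert [] (\<Union>j<length ts. (#) j ` (map vertices ts ! j))"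

definition edges :: "'d ptree \<Rightarrow> nat list set" where
  "edges t = vertices t - {[]}"

definition leaves :: "'d ptree \<Rightarrow> nat list set" where
  "leaves t = {v \<in> vertices t. \<forall>j. v @ [j] \<notin> vertices t}"

definition left_admissible :: "'d ptree \<Rightarrow> nat list set \<Rightarrow> bool" where
  "left_admissible t c \<longleftrightarrow> c \<subseteq> edges t \<and>
     (\<forall>l\<in>leaves t. \<forall>e\<in>c. \<forall>e'\<in>c. prefix e l \<and> prefix e' l \<longrightarrow> e = e') \<and>
     (\<forall>v j k. v @ [j] \<in> c \<and> k < j \<longrightarrow> v @ [k] \<in> c)"

definition cut_below :: "nat \<Rightarrow> nat list set \<Rightarrow> nat list set" where
  "cut_below j c = {p. j # p \<in> c}"

lemma size_nth_less [termination_simp]: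
  "j < length ts \<Longrightarrow> size (ts ! j) < Suc (size_list size ts)"
  by (metis less_Suc_eq_le less_or_eq_imp_le nth_mem size_list_estimation')

fun trunk :: "nat list set \<Rightarrow> 'd ptree \<Rightarrow> 'd ptree" where
  "trunk c (Node i ts) =
     Node i (map (\<lambda>j. trunk (cut_below j c) (ts ! j)) (filter (\<lambda>j. [j] \<notin> c) [0..<length ts]))"

text \<open>
  The first factor is the forest of the components cut off from the root; the remaining ones
  collect, recursively, the forests cut off from the other vertices of the trunk.
\<close>

fun pruned :: "nat list set \<Rightarrow> 'd ptree \<Rightarrow> ('d forest \<Rightarrow>\<^sub>0 real)" where
  "pruned c (Node i ts) =
     shuffle (basis (map (\<lambda>j. ts ! j) (filter (\<lambda>j. [j] \<in> c) [0..<length ts])))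
       (foldr shuffle
          (map (\<lambda>j. pruned (cut_below j c) (ts ! j)) (filter (\<lambda>j. [j] \<notin> c) [0..<length ts]))
          (basis []))"

text \<open>
  The new root of \<open>B\<^sub>+(\<omega>)\<close> is removed again by \<open>B\<^sub>-\<close>, so that its decoration (here \<open>0\<close>) is
  immaterial.
\<close>

definition Delta_MKW_forest :: "'d::zero forest \<Rightarrow> ('d forest \<times> 'd forest \<Rightarrow>\<^sub>0 real)" where
  "Delta_MKW_forest \<omega> =
     (\<Sum>c | left_admissible (Node 0 \<omega>) c.
        tensor (pruned c (Node 0 \<omega>)) (basis (branches (trunk c (Node 0 \<omega>)))))"

definition Delta_MKW ::
  "('d::zero forest \<Rightarrow>\<^sub>0 real) \<Rightarrow> ('d forest \<times> 'd forest \<Rightarrow>\<^sub>0 real)" where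
  "Delta_MKW = lin_ext Delta_MKW_forest"

lemma finite_vertices: "finite (vertices t)"
  by (induction t) auto

lemma finite_left_admissible: "finite {c. left_admissible t c}"
  by (rule finite_subset[of _ "Pow (vertices t)"])
    (auto simp: left_admissible_def edges_def finite_vertices)


section \<open>Planarly branched rough paths\<close>

definition convolution ::
  "(('d::zero forest \<Rightarrow>\<^sub>0 real) \<Rightarrow> real) \<Rightarrow> (('d forest \<Rightarrow>\<^sub>0 real) \<Rightarrow> real) \<Rightarrow>
   ('d forest \<Rightarrow>\<^sub>0 real) \<Rightarrow> real" where
  "convolution f g x = tensor_lift (\<lambda>y z. f y * g z) (Delta_MKW x)"

text \<open>
  On the whole line, the bound required of \<open>\<langle>\<XX>\<^bsub>st\<^esub>, x\<rangle>\<close> for all \<open>s \<noteq> t\<close> forces \<open>\<gamma> = 1\<close>, because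
  \<open>\<langle>\<XX>\<^bsub>st\<^esub>, \<bullet>\<^sub>0\<rangle> = t - s\<close>.  It is therefore imposed for \<open>0 < \<bar>t - s\<bar> \<le> h\<close> only, where \<open>h \<in> (0,\<infinity>]\<close>;
  the value \<open>h = \<infinity>\<close> gives the bound for all \<open>s \<noteq> t\<close>.  A bound on compact intervals of \<open>s\<close> and \<open>t\<close>
  alone would not ensure that \<open>t \<mapsto> \<langle>\<XX>\<^bsub>st\<^esub>, x\<rangle>\<close> is a tempered distribution.
\<close>

definition planarly_branched_rough_path ::
  "ereal \<Rightarrow> real \<Rightarrow> ('d::{finite,zero} \<Rightarrow> real \<Rightarrow> real) \<Rightarrow>
   (real \<Rightarrow> real \<Rightarrow> ('d forest \<Rightarrow>\<^sub>0 real) \<Rightarrow> real) \<Rightarrow> bool" where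
  "planarly_branched_rough_path h \<gamma> X \<XX> \<longleftrightarrow>
     0 < h \<and> 0 < \<gamma> \<and> \<gamma> \<le> 1 \<and>
     (\<forall>t. X 0 t = t) \<and>
     (\<forall>s t. linear (\<XX> s t)) \<and>
     (\<forall>s t. \<XX> s t (basis []) = 1) \<and>
     (\<forall>s t x y. \<XX> s t (shuffle x y) = \<XX> s t x * \<XX> s t y) \<and>
     (\<forall>s u t. convolution (\<XX> s u) (\<XX> u t) = \<XX> s t) \<and>
     (\<forall>\<omega>. bdd_above {\<bar>\<XX> s t (basis \<omega>)\<bar> / \<bar>t - s\<bar> powr (\<gamma> * forest_size \<omega>) | s t.
        s \<noteq> t \<and> ereal \<bar>t - s\<bar> \<le> h}) \<and>
     (\<forall>i s t. \<XX> s t (basis [Node i []]) = X i t - X i s)"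

definition locally_holder :: "real \<Rightarrow> (real \<Rightarrow> real) \<Rightarrow> bool" where
  "locally_holder a Y \<longleftrightarrow>
     (\<forall>R. bdd_above {\<bar>Y t - Y s\<bar> / \<bar>t - s\<bar> powr a | s t. s \<noteq> t \<and> \<bar>s\<bar> \<le> R \<and> \<bar>t\<bar> \<le> R})"


section \<open>The trees of the regularity structure\<close>

text \<open>Edge-decorated trees; an edge of decoration \<open>0\<close> counts as undecorated.\<close>

datatype 'd etree = ENode (out_edges: "('d \<times> 'd etree) list")

lemma size_snd_less [termination_simp]:
  fixes es :: "('d \<times> 'd etree) list"
  shows "e \<in> set es \<Longrightarrow> size (snd e) < Suc (size_list (size_prod (\<lambda>_. 0) size) es)"
proof -
  assume "e \<in> set es"
  then have "size_prod (\<lambda>_. 0) size e \<le> size_list (size_prod (\<lambda>_. 0) size) es"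
    by (rule size_list_estimation') simp
  then show ?thesis by (cases e) simp
qed

fun is_pb :: "'d::zero etree \<Rightarrow> bool" where
  "is_pb (ENode es) \<longleftrightarrow>
     (\<forall>e\<in>set es. fst e \<noteq> 0 \<longrightarrow> snd e = ENode []) \<and>
     (\<forall>e\<in>set (butlast es). fst e = 0) \<and>
     (\<forall>e\<in>set es. is_pb (snd e))"

typedef (overloaded) 'd::zero pbtree = "{t :: 'd etree. is_pb t}"
  by (rule exI[of _ "ENode []"]) simp

definition root_undecorated :: "'d::zero pbtree \<Rightarrow> bool" where
  "root_undecorated \<tau> \<longleftrightarrow> (\<forall>e\<in>set (out_edges (Rep_pbtree \<tau>)). fst e = 0)"

lemma root_undecorated_ex: "\<exists>\<tau>. root_undecorated \<tau>"
  by (rule exI[of _ "Abs_pbtree (ENode [])"]) (simp add: root_undecorated_def Abs_pbtree_inverse)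

text \<open>The basis of \<open>PB\<^sub>+\<close>, with \<open>incl\<close> the inclusion into the basis of \<open>PB\<close>.\<close>

typedef (overloaded) 'd::zero pbptree = "{\<tau> :: 'd pbtree. root_undecorated \<tau>}"
  morphisms incl Abs_pbptree
  using root_undecorated_ex by simp

fun phi_etree :: "'d::zero ptree \<Rightarrow> 'd etree" where
  "phi_etree (Node i ts) =
     ENode (map (\<lambda>t. (0, phi_etree t)) ts @ (if i = 0 then [] else [(i, ENode [])]))"

definition phi :: "'d::zero ptree \<Rightarrow> 'd pbtree" where
  "phi t = Abs_pbtree (phi_etree t)"

definition Bplus :: "'d::zero pbtree list \<Rightarrow> 'd pbptree" where
  "Bplus \<tau>s = Abs_pbptree (Abs_pbtree (ENode (map (\<lambda>\<tau>. (0, Rep_pbtree \<tau>)) \<tau>s)))"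

definition Bplus_phi :: "'d::zero forest \<Rightarrow> 'd pbptree" where
  "Bplus_phi \<omega> = Bplus (map phi \<omega>)"

definition bullet :: "'d::zero pbtree" where
  "bullet = Abs_pbtree (ENode [])"

text \<open>
  On trees whose root has exactly one outgoing edge, which is undecorated, \<open>Bminus\<close> removes the
  root; it is only ever applied to such trees.
\<close>

definition Bminus :: "'d::zero pbtree \<Rightarrow> 'd pbtree" where
  "Bminus = inv (\<lambda>\<tau>. incl (Bplus [\<tau>]))"

definition Bplus_phi_inv :: "'d::zero pbptree \<Rightarrow> 'd forest" where
  "Bplus_phi_inv = inv Bplus_phi"

definition tree_product ::
  "('d::zero pbptree \<Rightarrow>\<^sub>0 real) \<Rightarrow> ('d pbptree \<Rightarrow>\<^sub>0 real) \<Rightarrow> ('d pbptree \<Rightarrow>\<^sub>0 real)" where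
  "tree_product x y =
     lmap Bplus_phi (shuffle (lmap Bplus_phi_inv x) (lmap Bplus_phi_inv y))"

fun etree_degree :: "('d::zero \<Rightarrow> real) \<Rightarrow> 'd etree \<Rightarrow> real" where
  "etree_degree \<alpha> (ENode es) =
     sum_list (map (\<lambda>e. (if fst e = 0 then 1 else \<alpha> (fst e) - 1) + etree_degree \<alpha> (snd e)) es)"

definition tree_degree :: "('d::zero \<Rightarrow> real) \<Rightarrow> 'd pbtree \<Rightarrow> real" where
  "tree_degree \<alpha> \<tau> = etree_degree \<alpha> (Rep_pbtree \<tau>)"

definition degrees :: "('d::zero \<Rightarrow> real) \<Rightarrow> real set" where
  "degrees \<alpha> = range (tree_degree \<alpha>)"

definition homogeneous_part :: "('d::zero \<Rightarrow> real) \<Rightarrow> real \<Rightarrow> ('d pbtree \<Rightarrow>\<^sub>0 real) set" where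
  "homogeneous_part \<alpha> a = {x. \<forall>\<tau>\<in>Poly_Mapping.keys x. tree_degree \<alpha> \<tau> = a}"


subsection \<open>The coaction and the structure group\<close>

definition Delta_plus_planted ::
  "'d::zero pbptree \<Rightarrow> ('d pbptree \<times> 'd pbtree \<Rightarrow>\<^sub>0 real)" where
  "Delta_plus_planted p =
     lmap (map_prod Bplus_phi (incl \<circ> Bplus_phi)) (Delta_MKW (basis (Bplus_phi_inv p)))"

definition Delta_plus_tree :: "'d::zero pbtree \<Rightarrow> ('d pbptree \<times> 'd pbtree \<Rightarrow>\<^sub>0 real)" where
  "Delta_plus_tree \<tau> =
     (if root_undecorated \<tau> then Delta_plus_planted (Abs_pbptree \<tau>)
      else lmap (map_prod id Bminus)
             (Delta_plus_planted (Bplus [\<tau>]) - tensor (basis (Bplus [\<tau>])) (basis bullet)))"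

definition Delta_plus ::
  "('d::zero pbtree \<Rightarrow>\<^sub>0 real) \<Rightarrow> ('d pbptree \<times> 'd pbtree \<Rightarrow>\<^sub>0 real)" where
  "Delta_plus = lin_ext Delta_plus_tree"

text \<open>The unit of the tree product is the one-vertex tree \<open>Bplus []\<close>.\<close>

definition is_character :: "(('d::zero pbptree \<Rightarrow>\<^sub>0 real) \<Rightarrow> real) \<Rightarrow> bool" where
  "is_character g \<longleftrightarrow> linear g \<and> g (basis (Bplus [])) = 1 \<and>
     (\<forall>x y. g (tree_product x y) = g x * g y)"

definition Gamma_of ::
  "(('d::zero pbptree \<Rightarrow>\<^sub>0 real) \<Rightarrow> real) \<Rightarrow> ('d pbtree \<Rightarrow>\<^sub>0 real) \<Rightarrow> ('d pbtree \<Rightarrow>\<^sub>0 real)" where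
  "Gamma_of g x = tensor_lift (\<lambda>y z. g y *\<^sub>R z) (Delta_plus x)"

definition structure_group ::
  "(('d::zero pbtree \<Rightarrow>\<^sub>0 real) \<Rightarrow> ('d pbtree \<Rightarrow>\<^sub>0 real)) set" where
  "structure_group = {Gamma_of g | g. is_character g}"


section \<open>Schwartz functions and tempered distributions on the line\<close>

typedef schwartz =
  "{f :: real \<Rightarrow> real.
      (\<forall>m x. (deriv ^^ m) f field_differentiable at x) \<and>
      (\<forall>k m. bounded (range (\<lambda>x. x ^ k * (deriv ^^ m) f x)))}"
  morphisms schwartz_fun Abs_schwartz
proof -
  have "(deriv ^^ m) (\<lambda>_. 0) = (\<lambda>_. 0 :: real)" for m
    by (induction m) auto
  then show ?thesis
    by (intro exI[of _ "\<lambda>_. 0"]) auto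
qed

setup_lifting type_definition_schwartz

lemma higher_deriv_add_real:
  fixes f g :: "real \<Rightarrow> real"
  assumes "\<And>m x. (deriv ^^ m) f field_differentiable at x"
    and "\<And>m x. (deriv ^^ m) g field_differentiable at x"
  shows "(deriv ^^ m) (\<lambda>x. f x + g x) = (\<lambda>x. (deriv ^^ m) f x + (deriv ^^ m) g x)"
  by (induction m) (auto simp: assms)

lemma higher_deriv_cmult_real:
  fixes f :: "real \<Rightarrow> real"
  assumes "\<And>m x. (deriv ^^ m) f field_differentiable at x"
  shows "(deriv ^^ m) (\<lambda>x. c * f x) = (\<lambda>x. c * (deriv ^^ m) f x)"
  by (induction m) (auto simp: assms)

instantiation schwartz :: real_vector
begin

lift_definition zero_schwartz :: schwartz is "\<lambda>_. 0"
proof -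
  have "(deriv ^^ m) (\<lambda>_. 0) = (\<lambda>_. 0 :: real)" for m
    by (induction m) auto
  then show "?thesis" by auto
qed

lift_definition plus_schwartz :: "schwartz \<Rightarrow> schwartz \<Rightarrow> schwartz" is "\<lambda>f g x. f x + g x"
proof -
  fix f g :: "real \<Rightarrow> real"
  assume f: "(\<forall>m x. (deriv ^^ m) f field_differentiable at x) \<and>
      (\<forall>k m. bounded (range (\<lambda>x. x ^ k * (deriv ^^ m) f x)))"
    and g: "(\<forall>m x. (deriv ^^ m) g field_differentiable at x) \<and>
      (\<forall>k m. bounded (range (\<lambda>x. x ^ k * (deriv ^^ m) g x)))"
  have 1: "(deriv ^^ m) (\<lambda>x. f x + g x) = (\<lambda>x. (deriv ^^ m) f x + (deriv ^^ m) g x)" for m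
    using f g by (simp add: higher_deriv_add_real)
  have "bounded (range (\<lambda>x. x ^ k * (deriv ^^ m) f x + x ^ k * (deriv ^^ m) g x))" for k m
    using f g by (intro bounded_plus_comp) blast+
  then show "(\<forall>m x. (deriv ^^ m) (\<lambda>x. f x + g x) field_differentiable at x) \<and>
      (\<forall>k m. bounded (range (\<lambda>x. x ^ k * (deriv ^^ m) (\<lambda>x. f x + g x) x)))"
    using f g by (simp add: 1 distrib_left field_differentiable_add)
qed

lift_definition scaleR_schwartz :: "real \<Rightarrow> schwartz \<Rightarrow> schwartz" is "\<lambda>c f x. c * f x"
proof -
  fix c :: real and f :: "real \<Rightarrow> real"
  assume *: "(\<forall>m x. (deriv ^^ m) f field_differentiable at x) \<and>
      (\<forall>k m. bounded (range (\<lambda>x. x ^ k * (deriv ^^ m) f x)))"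
  have "bounded (range (\<lambda>x. x ^ k * (c * (deriv ^^ m) f x)))" for k m
  proof -
    have "bounded (range (\<lambda>x. c *\<^sub>R (x ^ k * (deriv ^^ m) f x)))"
      using * by (intro bounded_scaleR_comp) auto
    then show ?thesis by (simp add: mult.left_commute)
  qed
  then show "(\<forall>m x. (deriv ^^ m) (\<lambda>x. c * f x) field_differentiable at x) \<and>
      (\<forall>k m. bounded (range (\<lambda>x. x ^ k * (deriv ^^ m) (\<lambda>x. c * f x) x)))"
    using * by (auto simp: higher_deriv_cmult_real intro!: derivative_intros)
qed

definition uminus_schwartz :: "schwartz \<Rightarrow> schwartz" where
  "uminus_schwartz f = (-1) *\<^sub>R f"

definition minus_schwartz :: "schwartz \<Rightarrow> schwartz \<Rightarrow> schwartz" where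
  "minus_schwartz f g = f + (-1) *\<^sub>R g"

instance
proof
  fix a b :: real and f g h :: schwartz
  show "f + g + h = f + (g + h)" by transfer (simp add: add.assoc)
  show "f + g = g + f" by transfer (simp add: add.commute)
  show "0 + f = f" by transfer simp
  show "- f + f = 0" unfolding uminus_schwartz_def by transfer simp
  show "f - g = f + - g" by (simp add: minus_schwartz_def uminus_schwartz_def)
  show "a *\<^sub>R (f + g) = a *\<^sub>R f + a *\<^sub>R g" by transfer (simp add: distrib_left)
  show "(a + b) *\<^sub>R f = a *\<^sub>R f + b *\<^sub>R f" by transfer (simp add: distrib_right)
  show "a *\<^sub>R b *\<^sub>R f = (a * b) *\<^sub>R f" by transfer (simp add: mult.assoc)
  show "1 *\<^sub>R f = f" by transfer simp
qed

end

lift_definition schwartz_deriv :: "schwartz \<Rightarrow> schwartz" is deriv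
proof -
  fix f :: "real \<Rightarrow> real"
  assume *: "(\<forall>m x. (deriv ^^ m) f field_differentiable at x) \<and>
      (\<forall>k m. bounded (range (\<lambda>x. x ^ k * (deriv ^^ m) f x)))"
  have "(deriv ^^ m) (deriv f) = (deriv ^^ Suc m) f" for m
    by (simp add: funpow_swap1)
  then show "(\<forall>m x. (deriv ^^ m) (deriv f) field_differentiable at x) \<and>
      (\<forall>k m. bounded (range (\<lambda>x. x ^ k * (deriv ^^ m) (deriv f) x)))"
    using * by presburger
qed

definition schwartz_seminorm :: "nat \<Rightarrow> nat \<Rightarrow> schwartz \<Rightarrow> real" where
  "schwartz_seminorm k m f = (SUP x. \<bar>x ^ k * (deriv ^^ m) (schwartz_fun f) x\<bar>)"

instantiation schwartz :: topological_space
begin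

definition open_schwartz :: "schwartz set \<Rightarrow> bool" where
  "open_schwartz U \<longleftrightarrow>
     (\<forall>f\<in>U. \<exists>N. \<exists>e>0. \<forall>g. (\<forall>k\<le>N. \<forall>m\<le>N. schwartz_seminorm k m (g - f) < e) \<longrightarrow> g \<in> U)"

instance
proof
  show "open (UNIV :: schwartz set)"
    unfolding open_schwartz_def by (auto intro!: exI[of _ 1])
next
  fix S T :: "schwartz set"
  assume "open S" "open T"
  show "open (S \<inter> T)"
    unfolding open_schwartz_def
  proof
    fix f assume f: "f \<in> S \<inter> T"
    obtain N e where 1: "e > 0"
      "\<forall>g. (\<forall>k\<le>N. \<forall>m\<le>N. schwartz_seminorm k m (g - f) < e) \<longrightarrow> g \<in> S"
      using \<open>open S\<close> f unfolding open_schwartz_def by blast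
    obtain N' e' where 2: "e' > 0"
      "\<forall>g. (\<forall>k\<le>N'. \<forall>m\<le>N'. schwartz_seminorm k m (g - f) < e') \<longrightarrow> g \<in> T"
      using \<open>open T\<close> f unfolding open_schwartz_def by blast
    show "\<exists>N. \<exists>e>0. \<forall>g. (\<forall>k\<le>N. \<forall>m\<le>N. schwartz_seminorm k m (g - f) < e) \<longrightarrow> g \<in> S \<inter> T"
    proof (intro exI[of _ "max N N'"] exI[of _ "min e e'"] conjI allI impI)
      show "min e e' > 0" using 1 2 by simp
    next
      fix g assume g: "\<forall>k\<le>max N N'. \<forall>m\<le>max N N'. schwartz_seminorm k m (g - f) < min e e'"
      have "g \<in> S" using g by (intro 1(2)[rule_format]) auto
      moreover have "g \<in> T" using g by (intro 2(2)[rule_format]) auto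
      ultimately show "g \<in> S \<inter> T" by simp
    qed
  qed
next
  fix K :: "schwartz set set"
  assume K: "\<forall>S\<in>K. open S"
  show "open (\<Union>K)"
    unfolding open_schwartz_def
  proof
    fix f assume "f \<in> \<Union>K"
    then obtain S where S: "S \<in> K" "f \<in> S" by auto
    then obtain N e where "e > 0"
      "\<forall>g. (\<forall>k\<le>N. \<forall>m\<le>N. schwartz_seminorm k m (g - f) < e) \<longrightarrow> g \<in> S"
      using K unfolding open_schwartz_def by blast
    then show "\<exists>N. \<exists>e>0. \<forall>g. (\<forall>k\<le>N. \<forall>m\<le>N. schwartz_seminorm k m (g - f) < e) \<longrightarrow> g \<in> \<Union>K"
      using S by blast
  qed
qed

end

definition tempered_distributions :: "(schwartz \<Rightarrow> real) set" where
  "tempered_distributions = {T. linear T \<and> continuous_on UNIV T}"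

text \<open>The strong dual topology, i.e. uniform convergence on bounded sets of Schwartz functions.\<close>

definition schwartz_bounded :: "schwartz set \<Rightarrow> bool" where
  "schwartz_bounded B \<longleftrightarrow> (\<forall>k m. bdd_above (schwartz_seminorm k m ` B))"

definition strong_dual_topology :: "(schwartz \<Rightarrow> real) topology" where
  "strong_dual_topology = topology_generated_by
     {{S \<in> tempered_distributions. \<exists>d<e. \<forall>f\<in>B. \<bar>S f - T f\<bar> \<le> d} | T B e.
        T \<in> tempered_distributions \<and> schwartz_bounded B \<and> e > 0}"

definition fun_distribution :: "(real \<Rightarrow> real) \<Rightarrow> schwartz \<Rightarrow> real" where
  "fun_distribution h f = (LINT t|lborel. h t * schwartz_fun f t)"

definition distribution_deriv :: "(schwartz \<Rightarrow> real) \<Rightarrow> schwartz \<Rightarrow> real" where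
  "distribution_deriv T f = - T (schwartz_deriv f)"


section \<open>Models\<close>

text \<open>
  The locally convex direct sum topology on \<open>\<Oplus>a\<in>A. T a\<close>: the finest locally convex
  topology inducing on each \<open>T a\<close> a topology coarser than the norm topology of \<open>T a\<close>.
  The norm on \<open>'b \<Rightarrow>\<^sub>0 real\<close> is the \<open>l\<^sup>1\<close>-norm of the coefficients.  It enters only through
  its restriction to the summands, and if these are finite-dimensional, then any
  other norm yields the same topology.
\<close>

definition seminorm :: "('v::real_vector \<Rightarrow> real) \<Rightarrow> bool" where
  "seminorm p \<longleftrightarrow> (\<forall>x y. p (x + y) \<le> p x + p y) \<and> (\<forall>c x. p (c *\<^sub>R x) = \<bar>c\<bar> * p x)"

definition direct_sum_topology ::
  "real set \<Rightarrow> (real \<Rightarrow> 'v::real_normed_vector set) \<Rightarrow> 'v topology" where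
  "direct_sum_topology A T = topology_generated_by
     {{y. p (y - x) < e} | p x e. seminorm p \<and> (\<forall>a\<in>A. continuous_on (T a) p) \<and> e > 0}"

definition is_model ::
  "real set \<Rightarrow> (real \<Rightarrow> 'v::real_normed_vector set) \<Rightarrow> ('v \<Rightarrow> 'v) set \<Rightarrow>
   (real \<Rightarrow> 'v \<Rightarrow> schwartz \<Rightarrow> real) \<Rightarrow> (real \<Rightarrow> real \<Rightarrow> 'v \<Rightarrow> 'v) \<Rightarrow> bool" where
  "is_model A T G \<PP> \<Gamma> \<longleftrightarrow>
     (\<forall>x y. \<Gamma> x y \<in> G) \<and>
     (\<forall>x. \<Gamma> x x = id) \<and>
     (\<forall>x y z. \<Gamma> x y \<circ> \<Gamma> y z = \<Gamma> x z) \<and>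
     (\<forall>x v. \<PP> x v \<in> tempered_distributions) \<and>
     (\<forall>x f. linear (\<lambda>v. \<PP> x v f)) \<and>
     (\<forall>x. continuous_map (direct_sum_topology A T) strong_dual_topology (\<PP> x)) \<and>
     (\<forall>x y. \<PP> y = \<PP> x \<circ> \<Gamma> x y)"


section \<open>The maps built from a planarly branched rough path\<close>

definition model_Pi_tree ::
  "(real \<Rightarrow> real \<Rightarrow> ('d::zero forest \<Rightarrow>\<^sub>0 real) \<Rightarrow> real) \<Rightarrow> real \<Rightarrow> 'd pbtree \<Rightarrow> schwartz \<Rightarrow> real" where
  "model_Pi_tree \<XX> s \<tau> =
     (if root_undecorated \<tau>
      then fun_distribution (\<lambda>t. \<XX> s t (basis (Bplus_phi_inv (Abs_pbptree \<tau>))))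
      else distribution_deriv (fun_distribution (\<lambda>t. \<XX> s t (basis (Bplus_phi_inv (Bplus [\<tau>]))))))"

definition model_Pi ::
  "(real \<Rightarrow> real \<Rightarrow> ('d::zero forest \<Rightarrow>\<^sub>0 real) \<Rightarrow> real) \<Rightarrow>
   real \<Rightarrow> ('d pbtree \<Rightarrow>\<^sub>0 real) \<Rightarrow> schwartz \<Rightarrow> real" where
  "model_Pi \<XX> s x f = lin_ext (\<lambda>\<tau>. model_Pi_tree \<XX> s \<tau> f) x"

definition gamma_character ::
  "(real \<Rightarrow> real \<Rightarrow> ('d::zero forest \<Rightarrow>\<^sub>0 real) \<Rightarrow> real) \<Rightarrow>
   real \<Rightarrow> real \<Rightarrow> ('d pbptree \<Rightarrow>\<^sub>0 real) \<Rightarrow> real" where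
  "gamma_character \<XX> s t x = \<XX> s t (lmap Bplus_phi_inv x)"

definition model_Gamma ::
  "(real \<Rightarrow> real \<Rightarrow> ('d::zero forest \<Rightarrow>\<^sub>0 real) \<Rightarrow> real) \<Rightarrow>
   real \<Rightarrow> real \<Rightarrow> ('d pbtree \<Rightarrow>\<^sub>0 real) \<Rightarrow> ('d pbtree \<Rightarrow>\<^sub>0 real)" where
  "model_Gamma \<XX> s t = Gamma_of (gamma_character \<XX> t s)"


section \<open>The defining equations on trees\<close>

lemma is_pb_phi_etree: "is_pb (phi_etree t)"
proof (induction t)
  case (Node i ts)
  then show ?case by (auto simp: butlast_append dest: in_set_butlastD)
qed

lemma Rep_phi: "Rep_pbtree (phi t) = phi_etree t"
  by (simp add: phi_def Abs_pbtree_inverse is_pb_phi_etree)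

lemma Rep_Bplus:
  "Rep_pbtree (incl (Bplus \<tau>s)) = ENode (map (\<lambda>\<tau>. (0, Rep_pbtree \<tau>)) \<tau>s)" (is "_ = ?e")
proof -
  have "is_pb ?e"
    using Rep_pbtree by (auto dest: in_set_butlastD)
  then have 1: "Rep_pbtree (Abs_pbtree ?e) = ?e"
    by (simp add: Abs_pbtree_inverse)
  then have "root_undecorated (Abs_pbtree ?e)"
    by (simp add: root_undecorated_def)
  with 1 show ?thesis by (simp add: Bplus_def Abs_pbptree_inverse)
qed

lemma bullet_eq: "bullet = phi (Node 0 [])" "bullet = incl (Bplus [])"
proof -
  show "bullet = phi (Node 0 [])" by (simp add: bullet_def phi_def)
  show "bullet = incl (Bplus [])"
    using Rep_Bplus[of "[]"] by (metis bullet_def Rep_pbtree_inverse list.map(1))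
qed

lemma inj_Bplus: "inj Bplus"
proof (rule injI)
  fix \<tau>s \<sigma>s :: "'a pbtree list" assume "Bplus \<tau>s = Bplus \<sigma>s"
  then have "map snd (out_edges (Rep_pbtree (incl (Bplus \<tau>s)))) =
      map snd (out_edges (Rep_pbtree (incl (Bplus \<sigma>s))))" by (rule arg_cong)
  then have "map Rep_pbtree \<tau>s = map Rep_pbtree \<sigma>s" by (simp add: Rep_Bplus comp_def)
  then show "\<tau>s = \<sigma>s"
    by (rule injD[OF inj_mapI, rotated]) (simp add: inj_def Rep_pbtree_inject)
qed

lemma Bminus_Bplus [simp]: "Bminus (incl (Bplus [\<tau>])) = \<tau>"
proof -
  have "inj (\<lambda>\<tau>. incl (Bplus [\<tau>]))"
    using inj_Bplus by (auto simp: inj_def incl_inject)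
  then show ?thesis unfolding Bminus_def by (rule inv_f_f)
qed

lemma surj_Bplus: "surj Bplus"
proof (rule surjI)
  fix p :: "'a pbptree"
  obtain es where es: "Rep_pbtree (incl p) = ENode es" by (cases "Rep_pbtree (incl p)")
  have "is_pb (ENode es)" using Rep_pbtree[of "incl p"] es by simp
  then have pb: "\<forall>e\<in>set es. is_pb (snd e)" by simp
  have undec: "\<forall>e\<in>set es. fst e = 0"
    using incl[of p] es by (simp add: root_undecorated_def)
  have "(0, Rep_pbtree (Abs_pbtree (snd e))) = e" if "e \<in> set es" for e
    using that pb undec by (simp add: prod_eq_iff Abs_pbtree_inverse)
  then have "Rep_pbtree (incl (Bplus (map (Abs_pbtree \<circ> snd) es))) = Rep_pbtree (incl p)"
    by (simp add: Rep_Bplus es map_idI)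
  then have "Bplus (map (Abs_pbtree \<circ> snd) es) = p"
    by (simp only: Rep_pbtree_inject incl_inject)
  then show "Bplus (map (Abs_pbtree \<circ> snd) (out_edges (Rep_pbtree (incl p)))) = p"
    by (simp only: es etree.sel)
qed

lemma inj_phi_etree:
  fixes t u :: "'a::zero ptree"
  shows "phi_etree t = phi_etree u \<Longrightarrow> t = u"
proof (induction t arbitrary: u)
  case (Node i ts)
  obtain j us where u: "u = Node j us" by (cases u)
  let ?F = "map (\<lambda>t::'a ptree. (0::'a, phi_etree t))"
  let ?E = "\<lambda>i::'a. if i = 0 then [] else [(i, ENode [] :: 'a etree)]"
  have eq: "?F ts @ ?E i = ?F us @ ?E j" using Node.prems u by simp
  have "filter (\<lambda>e. fst e \<noteq> 0) (?F ts @ ?E i) = filter (\<lambda>e. fst e \<noteq> 0) (?F us @ ?E j)"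
    by (simp only: eq)
  moreover have "filter (\<lambda>e. fst e \<noteq> 0) (?F ts) = []" for ts :: "'a forest"
    by (simp add: filter_empty_conv)
  ultimately have E: "?E i = ?E j"
    by (simp only: filter_append) (auto split: if_splits)
  then have ij: "i = j" by (auto split: if_splits)
  have "?F ts = ?F us" using eq unfolding E by (simp only: append_same_eq)
  then have "map snd (?F ts) = map snd (?F us)" by (rule arg_cong)
  then have "map phi_etree ts = map phi_etree us" by (simp add: comp_def)
  then have len: "length ts = length us" and
    nth: "\<And>k. k < length ts \<Longrightarrow> phi_etree (ts ! k) = phi_etree (us ! k)"
    by (auto dest: map_eq_imp_length_eq simp: list_eq_iff_nth_eq)
  have "ts = us"
    using len nth Node.IH by (auto simp: list_eq_iff_nth_eq)
  then show ?case using u ij by simp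
qed

lemma ex_phi_etree: "is_pb e \<Longrightarrow> \<exists>t. phi_etree t = e"
proof (induction e rule: is_pb.induct)
  case (1 es)
  have pb: "is_pb (snd e)" if "e \<in> set es" for e using 1 that by simp
  have "\<exists>t. phi_etree t = snd e" if "e \<in> set es" for e using 1 that by simp
  then obtain h where h: "\<And>e. e \<in> set es \<Longrightarrow> phi_etree (h e) = snd e" by metis
  have undec: "\<exists>ts. map (\<lambda>t. (0, phi_etree t)) ts = fs"
    if "set fs \<subseteq> set es" "\<forall>e\<in>set fs. fst e = 0" for fs
  proof (rule exI[of _ "map h fs"])
    have "(0, phi_etree (h e)) = e" if "e \<in> set fs" for e
      using that \<open>set fs \<subseteq> set es\<close> \<open>\<forall>e\<in>set fs. fst e = 0\<close> h
      by (metis prod.collapse subsetD)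
    then show "map (\<lambda>t. (0, phi_etree t)) (map h fs) = fs"
      by (simp add: map_idI)
  qed
  show ?case
  proof (cases "\<forall>e\<in>set es. fst e = 0")
    case True
    then obtain ts where "map (\<lambda>t. (0, phi_etree t)) ts = es" using undec by blast
    then show ?thesis by (intro exI[of _ "Node 0 ts"]) simp
  next
    case False
    then have ne: "es \<noteq> []" by auto
    have bl: "\<forall>e\<in>set (butlast es). fst e = 0" using 1 by simp
    then have last: "fst (last es) \<noteq> 0"
      using False ne by (metis append_butlast_last_id in_set_conv_decomp set_ConsD
          rotate1.simps(2) set_rotate1)
    then have "snd (last es) = ENode []" using 1 ne by simp
    then have 2: "last es = (fst (last es), ENode [])" by (simp add: prod_eq_iff)
    obtain ts where ts: "map (\<lambda>t. (0, phi_etree t)) ts = butlast es"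
      using undec[of "butlast es"] bl by (auto dest: in_set_butlastD)
    have "phi_etree (Node (fst (last es)) ts) = ENode (butlast es @ [last es])"
      using last 2 ts by simp
    then have "phi_etree (Node (fst (last es)) ts) = ENode es"
      by (metis append_butlast_last_id ne)
    then show ?thesis by blast
  qed
qed

lemma bij_phi: "bij phi"
proof (rule bijI)
  show "inj phi" by (metis Rep_phi inj_phi_etree injI)
  show "surj phi"
    by (metis Rep_pbtree Rep_pbtree_inverse Rep_phi ex_phi_etree mem_Collect_eq surj_def)
qed

lemma bij_Bplus_phi: "bij (Bplus_phi :: 'a::zero forest \<Rightarrow> 'a pbptree)"
proof -
  have "inj (map (phi :: 'a ptree \<Rightarrow> 'a pbtree))"
    by (rule inj_mapI[OF bij_is_inj[OF bij_phi]])
  moreover have "surj (map (phi :: 'a ptree \<Rightarrow> 'a pbtree))"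
    by (rule surjI[of _ "map (inv phi)"])
      (simp add: comp_def surj_f_inv_f[OF bij_is_surj[OF bij_phi]])
  ultimately have "bij (Bplus \<circ> map (phi :: 'a ptree \<Rightarrow> 'a pbtree))"
    by (intro bij_comp bijI inj_Bplus surj_Bplus)
  then show ?thesis by (simp add: Bplus_phi_def[abs_def] comp_def)
qed

lemma Bplus_phi_inv_Bplus_phi [simp]: "Bplus_phi_inv (Bplus_phi \<omega>) = \<omega>"
  unfolding Bplus_phi_inv_def by (rule inv_f_f[OF bij_is_inj[OF bij_Bplus_phi]])

lemma root_undecorated_incl [simp]: "root_undecorated (incl p)"
  using incl by auto

lemma tree_product_Bplus_phi:
  "tree_product (basis (Bplus_phi \<omega>\<^sub>1)) (basis (Bplus_phi \<omega>\<^sub>2)) =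
     lmap Bplus_phi (shuffle (basis \<omega>\<^sub>1) (basis \<omega>\<^sub>2))"
  by (simp add: tree_product_def)

lemma Delta_plus_Bplus_phi:
  "Delta_plus (basis (incl (Bplus_phi \<omega>))) =
     lmap (map_prod Bplus_phi (incl \<circ> Bplus_phi)) (Delta_MKW (basis \<omega>))"
  by (simp add: Delta_plus_def Delta_plus_tree_def Delta_plus_planted_def incl_inverse)

lemma Delta_plus_decorated:
  assumes "\<not> root_undecorated \<tau>"
  shows "Delta_plus (basis \<tau>) =
     lmap (map_prod id Bminus)
       (Delta_plus (basis (incl (Bplus [\<tau>]))) - tensor (basis (Bplus [\<tau>])) (basis bullet))"
  using assms by (simp add: Delta_plus_def Delta_plus_tree_def incl_inverse)

lemma gamma_character_Bplus_phi:
  "gamma_character \<XX> s t (basis (Bplus_phi \<omega>)) = \<XX> s t (basis \<omega>)"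
  by (simp add: gamma_character_def)

lemma model_Pi_Bplus_phi:
  "model_Pi \<XX> s (basis (incl (Bplus_phi \<omega>))) = fun_distribution (\<lambda>t. \<XX> s t (basis \<omega>))"
  by (simp add: model_Pi_def model_Pi_tree_def incl_inverse fun_eq_iff)

lemma model_Pi_decorated:
  assumes "\<not> root_undecorated \<tau>"
  shows "model_Pi \<XX> s (basis \<tau>) =
     distribution_deriv (model_Pi \<XX> s (basis (incl (Bplus [\<tau>]))))"
  using assms
  by (simp add: model_Pi_def model_Pi_tree_def incl_inverse fun_eq_iff distribution_deriv_def)

end

theory Submission
  imports Defs "HOL-Probability.Sinc_Integral"
begin

text \<open>
  A character \<open>f\<close> acts on trees and forests by contracting the pruned part of the coproduct.
  For a character the sum over left admissible cuts turns into a recursion: the action on a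
  forest splits off a prefix, evaluates \<open>f\<close> on it and acts on the remaining trees one by one,
  and on a tree it acts on the forest of branches.  From this recursion one reads off
  \<open>L\<^sub>g \<circ> L\<^sub>f = L\<^sub>h\<close> for characters \<open>f\<close>, \<open>g\<close> whose convolution \<open>h\<close> is again a character,
  so that coassociativity is obtained without multiplicativity of the coproduct.  Transported
  along \<open>phi\<close>, the operator \<open>\<Gamma>\<^sub>x\<^sub>y\<close> is the action of \<open>\<XX>\<^sub>y\<^sub>x\<close> on trees, and Chen's relation gives
  the algebraic identities; for trees with a decorated edge at the root the two sides of
  \<open>\<Pi>\<^sub>y = \<Pi>\<^sub>x \<Gamma>\<^sub>x\<^sub>y\<close> differ before differentiation by a constant.  Chen's relation together with the
  local Hoelder bounds also yields that \<open>t \<mapsto> \<langle>\<XX>\<^sub>s\<^sub>t, \<omega>\<rangle>\<close> is continuous and of polynomial growth,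
  hence a tempered distribution.
\<close>

section \<open>Linear extensions\<close>

text \<open>Every tree of \<open>PB\<close>, with or without a decorated edge at the root, is
  \<open>phi\<close> of a decorated planar tree. Under this identification both clauses of the
  coaction become one action that keeps the root and its decoration: the term subtracted in the
  second clause is the cut of the edge that \<open>Bplus\<close> adds above the root. This is why
  the composition law is wanted on trees, although the coproduct lives on forests. That
  \<open>\<Gamma> x x\<close> is the identity requires \<open>\<XX> s s\<close> to be the counit.
  Chen's relation makes \<open>\<XX> s s\<close> a character equal to its own convolution square,
  and induction on the size then gives an equation a = a + a for its value a on a nonempty forest.
  The bounds on increments are local while temperedness is a global condition, so growth is
  controlled by an induction on the size of the forest, with Chen's relation leading from one time
  to a nearby one. Continuity into the strong dual rests on the finite dimension of the homogeneous
  parts, which holds because each vertex other than an undecorated root adds a positive amount to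
  the degree.\<close>

lemma lookup_scaleR [simp]: "Poly_Mapping.lookup (c *\<^sub>R x) a = c *\<^sub>R Poly_Mapping.lookup x a"
proof -
  have "finite {i. c *\<^sub>R Poly_Mapping.lookup x i \<noteq> 0}"
    by (rule finite_subset[OF _ finite_lookup[of x]]) auto
  then show ?thesis by (simp add: scaleR_poly_mapping_def)
qed

lemma lin_ext_superset:
  assumes "finite S" "Poly_Mapping.keys x \<subseteq> S"
  shows "lin_ext F x = (\<Sum>a\<in>S. Poly_Mapping.lookup x a *\<^sub>R F a)"
  unfolding lin_ext_def by (rule sum.mono_neutral_left) (use assms in \<open>auto simp: in_keys_iff\<close>)

lemma linear_lin_ext: "linear (lin_ext F)"
proof (rule linearI)
  fix x y :: "'a \<Rightarrow>\<^sub>0 real" and c :: real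
  let ?S = "Poly_Mapping.keys x \<union> Poly_Mapping.keys y"
  have "lin_ext F (x + y) = (\<Sum>a\<in>?S. Poly_Mapping.lookup (x + y) a *\<^sub>R F a)"
    by (rule lin_ext_superset) (auto simp: keys_add)
  also have "\<dots> = (\<Sum>a\<in>?S. Poly_Mapping.lookup x a *\<^sub>R F a) + (\<Sum>a\<in>?S. Poly_Mapping.lookup y a *\<^sub>R F a)"
    by (simp add: lookup_add scaleR_add_left sum.distrib)
  also have "\<dots> = lin_ext F x + lin_ext F y"
    by (simp add: lin_ext_superset[of ?S])
  finally show "lin_ext F (x + y) = lin_ext F x + lin_ext F y" .
  have "lin_ext F (c *\<^sub>R x) = (\<Sum>a\<in>Poly_Mapping.keys x. Poly_Mapping.lookup (c *\<^sub>R x) a *\<^sub>R F a)"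
    by (rule lin_ext_superset) (auto simp: in_keys_iff)
  then show "lin_ext F (c *\<^sub>R x) = c *\<^sub>R lin_ext F x"
    by (simp add: lin_ext_def scaleR_sum_right)
qed

lemma lin_ext_basis_id: "lin_ext basis x = x"
proof (rule poly_mapping_eqI)
  fix a
  have "Poly_Mapping.lookup (lin_ext basis x) a =
      (\<Sum>b\<in>Poly_Mapping.keys x. if b = a then Poly_Mapping.lookup x b else 0)"
    unfolding lin_ext_def lookup_sum by (rule sum.cong) (auto simp: lookup_single when_def)
  then show "Poly_Mapping.lookup (lin_ext basis x) a = Poly_Mapping.lookup x a"
    by (simp add: in_keys_iff)
qed

lemma linear_lin_ext_comp:
  assumes "linear g"
  shows "g (lin_ext F x) = lin_ext (\<lambda>a. g (F a)) x"
  unfolding lin_ext_def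
  by (simp add: linear_sum[OF assms] linear_cmul[OF assms])

lemma linear_eq_lin_ext:
  assumes "linear g"
  shows "g x = lin_ext (\<lambda>a. g (basis a)) x"
  using linear_lin_ext_comp[OF assms, of basis x] by (simp add: lin_ext_basis_id)

lemma linear_eq_on_basis:
  assumes "linear f" "linear g" "\<And>a. f (basis a) = g (basis a)"
  shows "f x = g x"
  using linear_eq_lin_ext[OF assms(1), of x] linear_eq_lin_ext[OF assms(2), of x] assms(3) by simp

lemma linear_lin_ext_fun:
  assumes "\<And>a. linear (\<lambda>y. F y a)"
  shows "linear (\<lambda>y. lin_ext (F y) x)"
  unfolding lin_ext_def
  by (intro linear_compose_sum ballI linear_compose_scale_right assms)

lemma linear_bilin_ext_left: "linear (\<lambda>x. bilin_ext F x y)"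
  unfolding bilin_ext_def by (rule linear_lin_ext)

lemma linear_bilin_ext_right: "linear (bilin_ext F x)"
  unfolding bilin_ext_def
  by (rule linear_lin_ext_fun) (rule linear_lin_ext)

lemma bilin_ext_basis_left [simp]: "bilin_ext F (basis a) y = lin_ext (F a) y"
  by (simp add: bilin_ext_def)

lemma linear_lmap: "linear (lmap h)"
  unfolding lmap_def by (rule linear_lin_ext)

lemma lin_ext_lmap: "lin_ext F (lmap h x) = lin_ext (\<lambda>a. F (h a)) x"
  unfolding lmap_def by (simp add: linear_lin_ext_comp linear_lin_ext)

lemma lmap_lmap: "lmap g (lmap h x) = lmap (\<lambda>a. g (h a)) x"
  unfolding lmap_def[of g] lin_ext_lmap by (simp add: lmap_def)

lemma lmap_id: "lmap (\<lambda>a. a) x = x"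
  by (simp add: lmap_def lin_ext_basis_id)

lemma linear_tensor_lift: "linear (tensor_lift \<beta>)"
  unfolding tensor_lift_def by (rule linear_lin_ext)

lemma linear_tensor_left: "linear (\<lambda>x. tensor x y)"
  unfolding tensor_def by (rule linear_bilin_ext_left)

lemma tensor_basis [simp]: "tensor (basis a) (basis b) = basis (a, b)"
  by (simp add: tensor_def)

lemma tensor_lift_basis [simp]: "tensor_lift \<beta> (basis (a, b)) = \<beta> (basis a) (basis b)"
  by (simp add: tensor_lift_def)

text \<open>In each summand of the coproduct the trunk is a single basis vector, so only the pruned
  part has to be expanded linearly.\<close>

lemma tensor_lift_tensor_basis:
  assumes "linear (\<lambda>x. \<beta> x (basis b))"
  shows "tensor_lift \<beta> (tensor x (basis b)) = \<beta> x (basis b)"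
  by (rule linear_eq_on_basis[OF linear_compose[OF linear_tensor_left linear_tensor_lift,
        unfolded comp_def] assms]) simp

lemma lmap_map_prod_tensor_basis:
  "lmap (map_prod g h) (tensor x (basis b)) = tensor (lmap g x) (basis (h b))"
  by (rule linear_eq_on_basis[OF linear_compose[OF linear_tensor_left linear_lmap, unfolded comp_def]
        linear_compose[OF linear_lmap linear_tensor_left, unfolded comp_def]]) simp

lemma norm_poly_mapping_eq:
  fixes x :: "'a \<Rightarrow>\<^sub>0 real"
  shows "norm x = (\<Sum>a\<in>Poly_Mapping.keys x. \<bar>Poly_Mapping.lookup x a\<bar>)"
  by (simp add: norm_poly_mapping_def dist_poly_mapping_def)

section \<open>Left admissible cuts\<close>

lemma Nil_in_vertices [simp]: "[] \<in> vertices t"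
  by (cases t) simp

lemma Cons_in_vertices [simp]:
  "j # p \<in> vertices (Node i ts) \<longleftrightarrow> j < length ts \<and> p \<in> vertices (ts ! j)"
  by auto

lemma Cons_in_leaves:
  "j # p \<in> leaves (Node i ts) \<longleftrightarrow> j < length ts \<and> p \<in> leaves (ts ! j)"
  by (auto simp: leaves_def simp del: vertices.simps)

lemma Nil_in_leaves: "[] \<in> leaves (Node i ts) \<longleftrightarrow> ts = []"
  by (auto simp: leaves_def simp del: vertices.simps)

lemma Cons_in_edges:
  "j # p \<in> edges (Node i ts) \<longleftrightarrow> j < length ts \<and> p \<in> vertices (ts ! j)"
  by (auto simp: edges_def simp del: vertices.simps)

text \<open>Admissibility compares cut edges only along paths to leaves. The leaf found here brings
  two cut edges, one below the other, onto a common path.\<close>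

lemma ex_leaf_below: "v \<in> vertices t \<Longrightarrow> \<exists>l\<in>leaves t. prefix v l"
proof (induction t arbitrary: v)
  case (Node i ts)
  show ?case
  proof (cases v)
    case Nil
    show ?thesis
    proof (cases "ts = []")
      case True
      then show ?thesis using Nil Nil_in_leaves[of i ts] by auto
    next
      case False
      then have "0 < length ts" by simp
      with Node.IH[of "ts ! 0" "[]"] obtain l where "l \<in> leaves (ts ! 0)" by auto
      with \<open>0 < length ts\<close> Nil show ?thesis
        by (intro bexI[of _ "0 # l"]) (auto simp: Cons_in_leaves)
    qed
  next
    case (Cons j p)
    with Node.prems have j: "j < length ts" "p \<in> vertices (ts ! j)"
      by (auto simp del: vertices.simps)
    with Node.IH[of "ts ! j" p] obtain l where "l \<in> leaves (ts ! j)" "prefix p l" by auto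
    with j Cons show ?thesis by (intro bexI[of _ "j # l"]) (auto simp: Cons_in_leaves)
  qed
qed

text \<open>Assembles a cut from the root downwards. The condition on left neighbours makes the cut
  root edges an initial segment, of length \<open>k\<close>; the first \<open>k\<close> branches
  fall off whole, and \<open>cs ! j\<close> is the cut inside branch \<open>k + j\<close>.\<close>

definition node_cut :: "nat \<Rightarrow> nat list set list \<Rightarrow> nat list set" where
  "node_cut k cs = {[j] | j. j < k} \<union> {(k + j) # p | j p. j < length cs \<and> p \<in> cs ! j}"

lemma Nil_notin_cut: "left_admissible t c \<Longrightarrow> [] \<notin> c"
  by (auto simp: left_admissible_def edges_def)

lemma left_admissible_node_cut:
  assumes k: "k \<le> length ts" and len: "length cs = length ts - k"
    and cs: "\<And>j. j < length cs \<Longrightarrow> left_admissible (ts ! (k + j)) (cs ! j)"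
  shows "left_admissible (Node i ts) (node_cut k cs)"
  unfolding left_admissible_def
proof (intro conjI ballI allI impI subsetI)
  fix e assume "e \<in> node_cut k cs"
  then consider j where "e = [j]" "j < k"
    | j p where "e = (k + j) # p" "j < length cs" "p \<in> cs ! j"
    by (auto simp: node_cut_def)
  then show "e \<in> edges (Node i ts)"
  proof cases
    case 1
    then show ?thesis using k by (simp add: Cons_in_edges)
  next
    case 2
    then have "p \<in> vertices (ts ! (k + j))" "k + j < length ts"
      using len cs[of j] by (auto simp: left_admissible_def edges_def)
    then show ?thesis using 2 by (simp add: Cons_in_edges)
  qed
next
  fix l e e'
  assume l: "l \<in> leaves (Node i ts)" and e: "e \<in> node_cut k cs" "e' \<in> node_cut k cs"
    and pre: "prefix e l \<and> prefix e' l"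
  have ne: "e \<noteq> []" "e' \<noteq> []" using e by (auto simp: node_cut_def)
  obtain j l' where l': "l = j # l'" using ne pre by (cases l) auto
  obtain p where p: "e = j # p" "prefix p l'" using ne pre l' by (cases e) auto
  obtain q where q: "e' = j # q" "prefix q l'" using ne pre l' by (cases e') auto
  have lj: "l' \<in> leaves (ts ! j)" using l l' by (simp add: Cons_in_leaves)
  show "e = e'"
  proof (cases "j < k")
    case True
    then show ?thesis using e p q by (auto simp: node_cut_def)
  next
    case False
    then have "p \<in> cs ! (j - k)" "q \<in> cs ! (j - k)" "j - k < length cs" "k + (j - k) = j"
      using e p q by (auto simp: node_cut_def)
    then have "p = q" using cs[of "j - k"] lj p q by (auto simp: left_admissible_def)
    then show ?thesis using p q by simp
  qed
next
  fix v j m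
  assume a: "v @ [j] \<in> node_cut k cs \<and> m < j"
  show "v @ [m] \<in> node_cut k cs"
  proof (cases v)
    case Nil
    \<comment> \<open>An address of length one cannot stem from a cut inside a branch, because such
      a cut omits the empty address; so \<open>[j]\<close> is one of the cut root edges.\<close>
    have "[] \<notin> cs ! i" if "i < length cs" for i
      using Nil_notin_cut[OF cs[OF that]] .
    then have "j < k" using Nil a by (auto simp: node_cut_def)
    then show ?thesis using Nil a by (auto simp: node_cut_def)
  next
    case (Cons i' w)
    then have "w @ [j] \<in> cs ! (i' - k)" "i' - k < length cs" "k + (i' - k) = i'"
      using a by (auto simp: node_cut_def)
    then have "w @ [m] \<in> cs ! (i' - k)"
      using cs[of "i' - k"] a by (auto simp: left_admissible_def)
    with Cons \<open>i' - k < length cs\<close> \<open>k + (i' - k) = i'\<close> show ?thesis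
      unfolding node_cut_def by (intro UnI2 CollectI exI[of _ "i' - k"] exI[of _ "w @ [m]"]) auto
  qed
qed

lemma left_admissible_eq_node_cut:
  assumes c: "left_admissible (Node i ts) c"
  obtains k cs where "k \<le> length ts" "length cs = length ts - k"
    "\<And>j. j < length cs \<Longrightarrow> left_admissible (ts ! (k + j)) (cs ! j)" "c = node_cut k cs"
proof -
  have edges: "c \<subseteq> edges (Node i ts)"
    and leaf: "\<And>l e e'. l \<in> leaves (Node i ts) \<Longrightarrow> e \<in> c \<Longrightarrow> e' \<in> c \<Longrightarrow>
      prefix e l \<Longrightarrow> prefix e' l \<Longrightarrow> e = e'"
    and left: "\<And>v j k. v @ [j] \<in> c \<Longrightarrow> k < j \<Longrightarrow> v @ [k] \<in> c"
    using c by (auto simp: left_admissible_def)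
  \<comment> \<open>The first root edge that is kept. The index \<open>length ts\<close> shows that
    the minimum exists, as it belongs to no edge.\<close>
  define k where "k = (LEAST j. [j] \<notin> c)"
  have len: "[length ts] \<notin> c" using edges by (auto simp: edges_def)
  have kc: "[k] \<notin> c" unfolding k_def by (rule LeastI[of "\<lambda>j. [j] \<notin> c", OF len])
  have k: "k \<le> length ts" unfolding k_def by (rule Least_le) (rule len)
  have sing: "[j] \<in> c \<longleftrightarrow> j < k" for j
    using not_less_Least[of j "\<lambda>j. [j] \<notin> c"] left[of "[]" j k] kc
    by (metis append_Nil k_def nat_neq_iff)
  define cs where "cs = map (\<lambda>j. cut_below j c) [k..<length ts]"
  have lencs: "length cs = length ts - k" by (simp add: cs_def)
  have csj: "cs ! j = cut_below (k + j) c" if "j < length cs" for j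
    using that by (simp add: cs_def)
  have "left_admissible (ts ! (k + j)) (cs ! j)" if j: "j < length cs" for j
    unfolding csj[OF j] left_admissible_def
  proof (intro conjI ballI allI impI subsetI)
    have kj: "k + j < length ts" using j lencs by simp
    fix e assume "e \<in> cut_below (k + j) c"
    then have e: "(k + j) # e \<in> c" by (simp add: cut_below_def)
    then have "e \<noteq> []" using sing[of "k + j"] by auto
    then show "e \<in> edges (ts ! (k + j))"
      using e edges by (auto simp: Cons_in_edges edges_def simp del: vertices.simps)
    fix l e'
    assume "l \<in> leaves (ts ! (k + j))" "e' \<in> cut_below (k + j) c" "prefix e l \<and> prefix e' l"
    then show "e = e'"
      using leaf[of "(k + j) # l" "(k + j) # e" "(k + j) # e'"] e kj
      by (auto simp: Cons_in_leaves cut_below_def)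
  next
    fix v m m'
    assume "v @ [m] \<in> cut_below (k + j) c \<and> m' < m"
    then show "v @ [m'] \<in> cut_below (k + j) c"
      using left[of "(k + j) # v" m m'] by (auto simp: cut_below_def)
  qed
  moreover have "c = node_cut k cs"
  proof (intro set_eqI iffI)
    fix e assume e: "e \<in> c"
    then obtain j p where jp: "e = j # p" "j < length ts" "p \<in> vertices (ts ! j)"
      using edges by (cases e) (auto simp: edges_def)
    show "e \<in> node_cut k cs"
    proof (cases "j < k")
      case True
      \<comment> \<open>Nothing is cut below a cut root edge: a leaf beyond \<open>p\<close> would
        have both \<open>[j]\<close> and \<open>j # p\<close> on its path.\<close>
      have "p = []"
      proof -
        obtain l where "l \<in> leaves (ts ! j)" "prefix p l"
          using ex_leaf_below jp by blast
        then show ?thesis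
          using leaf[of "j # l" "[j]" e] e jp True sing by (auto simp: Cons_in_leaves)
      qed
      then show ?thesis using True jp by (auto simp: node_cut_def)
    next
      case False
      then have "j - k < length cs" "p \<in> cs ! (j - k)" "j = k + (j - k)"
        using jp lencs e csj[of "j - k"] by (auto simp: cut_below_def)
      then show ?thesis using jp unfolding node_cut_def by blast
    qed
  next
    fix e assume "e \<in> node_cut k cs"
    then show "e \<in> c"
      using sing csj by (auto simp: node_cut_def cut_below_def)
  qed
  ultimately show thesis using that k lencs by blast
qed

section \<open>Trunk and pruned part of an assembled cut\<close>

lemma singleton_in_node_cut:
  assumes "\<And>j. j < length cs \<Longrightarrow> [] \<notin> cs ! j"
  shows "[j] \<in> node_cut k cs \<longleftrightarrow> j < k"
  using assms by (auto simp: node_cut_def)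

lemma cut_below_node_cut:
  "j < length cs \<Longrightarrow> cut_below (k + j) (node_cut k cs) = cs ! j"
  by (auto simp: node_cut_def cut_below_def)

lemma filter_upt_less: "k \<le> n \<Longrightarrow> filter (\<lambda>j. j < k) [0..<n] = [0..<k]"
proof -
  assume "k \<le> n"
  then have "[0..<n] = [0..<k] @ [k..<n]"
    using upt_add_eq_append[of 0 k "n - k"] by simp
  then show ?thesis by (simp add: filter_id_conv filter_empty_conv)
qed

lemma filter_upt_not_less: "k \<le> n \<Longrightarrow> filter (\<lambda>j. \<not> j < k) [0..<n] = [k..<n]"
proof -
  assume "k \<le> n"
  then have "[0..<n] = [0..<k] @ [k..<n]"
    using upt_add_eq_append[of 0 k "n - k"] by simp
  then show ?thesis by (simp add: filter_id_conv filter_empty_conv)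
qed

lemma map_node_cut:
  assumes "length cs = length ts - k"
  shows "map (\<lambda>j. F (cut_below j (node_cut k cs)) (ts ! j)) [k..<length ts] =
    map2 F cs (drop k ts)"
proof (rule nth_equalityI)
  fix j assume "j < length (map (\<lambda>j. F (cut_below j (node_cut k cs)) (ts ! j)) [k..<length ts])"
  then have "j < length cs" using assms by simp
  then show "map (\<lambda>j. F (cut_below j (node_cut k cs)) (ts ! j)) [k..<length ts] ! j =
      map2 F cs (drop k ts) ! j"
    using assms by (simp add: cut_below_node_cut)
qed (use assms in simp)

lemma trunk_node_cut:
  assumes "k \<le> length ts" "length cs = length ts - k"
    "\<And>j. j < length cs \<Longrightarrow> [] \<notin> cs ! j"
  shows "trunk (node_cut k cs) (Node i ts) = Node i (map2 trunk cs (drop k ts))"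
  using map_node_cut[OF assms(2), of trunk] assms(1)
  by (simp add: singleton_in_node_cut[OF assms(3)] filter_upt_not_less)

lemma pruned_node_cut:
  assumes "k \<le> length ts" "length cs = length ts - k"
    "\<And>j. j < length cs \<Longrightarrow> [] \<notin> cs ! j"
  shows "pruned (node_cut k cs) (Node i ts) =
    shuffle (basis (take k ts)) (foldr shuffle (map2 pruned cs (drop k ts)) (basis []))"
proof -
  have "map ((!) ts) [0..<k] = take k ts"
    using assms(1) by (simp add: map_nth take_map[symmetric] list_eq_iff_nth_eq)
  then show ?thesis
    using map_node_cut[OF assms(2), of pruned] assms(1)
    by (simp add: singleton_in_node_cut[OF assms(3)] filter_upt_less filter_upt_not_less)
qed

section \<open>Summation over cuts, decomposed at the root\<close>

definition cuts :: "'d ptree \<Rightarrow> nat list set set" where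
  "cuts t = {c. left_admissible t c}"

lemma in_listset_iff:
  "xs \<in> listset As \<longleftrightarrow> length xs = length As \<and> (\<forall>j<length As. xs ! j \<in> As ! j)"
proof (induction As arbitrary: xs)
  case (Cons A As)
  show ?case
    by (cases xs) (auto simp: set_Cons_def Cons.IH nth_Cons' less_Suc_eq_0_disj)
qed auto

text \<open>The number \<open>k\<close> is recovered from a cut through its addresses of length one,
  and the branch cuts through \<open>cut_below\<close>. A sum over the cuts of a tree thereby splits
  into independent sums over the cuts of its remaining branches.\<close>

lemma bij_betw_node_cut:
  "bij_betw (\<lambda>(k, cs). node_cut k cs)
     (SIGMA k:{..length ts}. listset (map cuts (drop k ts))) (cuts (Node i ts))"
  (is "bij_betw ?F ?A ?B")
proof (rule bij_betw_imageI)
  have *: "length cs = length ts - k \<and> (\<forall>j<length cs. left_admissible (ts ! (k + j)) (cs ! j))"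
    if "cs \<in> listset (map cuts (drop k ts))" for k cs
    using that by (auto simp: in_listset_iff cuts_def)
  have sing: "[j] \<in> node_cut k cs \<longleftrightarrow> j < k" if "cs \<in> listset (map cuts (drop k ts))" for j k cs
    using *[OF that] by (intro singleton_in_node_cut) (blast dest: Nil_notin_cut)
  show "inj_on ?F ?A"
  proof (rule inj_onI, clarify)
    fix k cs k' cs'
    assume cs: "cs \<in> listset (map cuts (drop k ts))" "cs' \<in> listset (map cuts (drop k' ts))"
      and eq: "node_cut k cs = node_cut k' cs'"
    have "k = k'"
      using sing[OF cs(1)] sing[OF cs(2)] eq by (metis nat_neq_iff)
    moreover have "cs = cs'"
    proof (rule nth_equalityI)
      show "length cs = length cs'" using * cs \<open>k = k'\<close> by auto
      then show "cs ! j = cs' ! j" if "j < length cs" for j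
        using cut_below_node_cut[of j cs k] cut_below_node_cut[of j cs' k] that eq \<open>k = k'\<close> by simp
    qed
    ultimately show "k = k' \<and> cs = cs'" ..
  qed
  show "?F ` ?A = ?B"
  proof (intro equalityI subsetI)
    fix c assume "c \<in> ?F ` ?A"
    then show "c \<in> ?B"
      using * by (auto simp: cuts_def intro!: left_admissible_node_cut)
  next
    fix c assume "c \<in> ?B"
    then have "left_admissible (Node i ts) c" by (simp add: cuts_def)
    then show "c \<in> ?F ` ?A"
    proof (rule left_admissible_eq_node_cut)
      fix k cs
      assume "k \<le> length ts" "length cs = length ts - k" "c = node_cut k cs"
        "\<And>j. j < length cs \<Longrightarrow> left_admissible (ts ! (k + j)) (cs ! j)"
      then show ?thesis
        by (intro image_eqI[of _ _ "(k, cs)"]) (auto simp: in_listset_iff cuts_def)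
    qed
  qed
qed

lemma finite_cuts: "finite (cuts t)"
  unfolding cuts_def by (rule finite_left_admissible)

lemma finite_listset_cuts: "finite (listset (map cuts ts))"
proof (induction ts)
  case (Cons t ts)
  have "listset (map cuts (t # ts)) = (\<lambda>(c, cs). c # cs) ` (cuts t \<times> listset (map cuts ts))"
    by (auto simp: set_Cons_def)
  then show ?case by (simp only:) (intro finite_imageI finite_cartesian_product finite_cuts Cons)
qed simp

lemma sum_listset_Cons:
  "(\<Sum>cs\<in>listset (A # As). F cs) = (\<Sum>c\<in>A. \<Sum>cs\<in>listset As. F (c # cs))"
proof -
  have "listset (A # As) = (\<lambda>(c, cs). c # cs) ` (A \<times> listset As)"
    by (auto simp: set_Cons_def)
  then have "(\<Sum>cs\<in>listset (A # As). F cs) = (\<Sum>(c, cs)\<in>A \<times> listset As. F (c # cs))"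
    by (simp only:) (subst sum.reindex, auto simp: inj_on_def intro!: sum.cong)
  then show ?thesis by (simp add: sum.cartesian_product)
qed

lemma sum_cuts_Node:
  "(\<Sum>c\<in>cuts (Node i ts). F c) =
     (\<Sum>k\<le>length ts. \<Sum>cs\<in>listset (map cuts (drop k ts)). F (node_cut k cs))"
proof -
  have "(\<Sum>c\<in>cuts (Node i ts). F c) =
      (\<Sum>(k, cs)\<in>(SIGMA k:{..length ts}. listset (map cuts (drop k ts))). F (node_cut k cs))"
    by (subst sum.reindex_bij_betw[OF bij_betw_node_cut, symmetric]) (simp add: case_prod_unfold)
  then show ?thesis
    by (subst sum.Sigma) (auto simp: finite_listset_cuts)
qed

lemma listset_cuts_D:
  assumes "cs \<in> listset (map cuts (drop k ts))"
  shows "length cs = length ts - k" "\<And>j. j < length cs \<Longrightarrow> [] \<notin> cs ! j"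
  using assms by (auto simp: in_listset_iff cuts_def dest: Nil_notin_cut)

section \<open>The action of characters on trees\<close>

definition forest_character :: "(('d forest \<Rightarrow>\<^sub>0 real) \<Rightarrow> real) \<Rightarrow> bool" where
  "forest_character f \<longleftrightarrow> linear f \<and> f (basis []) = 1 \<and> (\<forall>x y. f (shuffle x y) = f x * f y)"

text \<open>Cuts of the tree itself, without an additional root: the root of \<open>t\<close> always
  survives. This is the form that the coaction on \<open>PB\<close> takes after transport along
  \<open>phi\<close>.\<close>

definition act_tree :: "(('d forest \<Rightarrow>\<^sub>0 real) \<Rightarrow> real) \<Rightarrow> 'd ptree \<Rightarrow> ('d ptree \<Rightarrow>\<^sub>0 real)" where
  "act_tree f t = (\<Sum>c\<in>cuts t. f (pruned c t) *\<^sub>R basis (trunk c t))"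

text \<open>For linear \<open>f\<close> this is \<open>f \<otimes> id\<close> applied to
  \<open>Delta_MKW_forest\<close>.\<close>

definition act_forest ::
  "(('d::zero forest \<Rightarrow>\<^sub>0 real) \<Rightarrow> real) \<Rightarrow> 'd forest \<Rightarrow> ('d forest \<Rightarrow>\<^sub>0 real)" where
  "act_forest f \<omega> = (\<Sum>c\<in>cuts (Node 0 \<omega>).
     f (pruned c (Node 0 \<omega>)) *\<^sub>R basis (branches (trunk c (Node 0 \<omega>))))"

definition cat :: "('a \<Rightarrow>\<^sub>0 real) \<Rightarrow> ('a list \<Rightarrow>\<^sub>0 real) \<Rightarrow> ('a list \<Rightarrow>\<^sub>0 real)" where
  "cat = bilin_ext (\<lambda>a b. basis (a # b))"

text \<open>For a character \<open>f\<close> this is the part of the action on forests in which no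
  edge at the added root is cut, so that each tree is treated separately and the images are
  concatenated.\<close>

primrec act_word :: "(('d forest \<Rightarrow>\<^sub>0 real) \<Rightarrow> real) \<Rightarrow> 'd forest \<Rightarrow> ('d forest \<Rightarrow>\<^sub>0 real)" where
  "act_word f [] = basis []"
| "act_word f (t # ts) = cat (act_tree f t) (act_word f ts)"

lemma linear_cat_left: "linear (\<lambda>x. cat x y)"
  unfolding cat_def by (rule linear_bilin_ext_left)

lemma linear_cat_right: "linear (cat x)"
  unfolding cat_def by (rule linear_bilin_ext_right)

lemma cat_basis: "cat (basis a) y = lmap ((#) a) y"
  by (simp add: cat_def lmap_def)

lemma forest_characterD:
  assumes "forest_character f"
  shows "linear f" "f (basis []) = 1" "f (shuffle x y) = f x * f y"
  using assms by (simp_all add: forest_character_def)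

text \<open>Distributivity: choosing one cut in every tree amounts to choosing one summand in every
  letter of the expanded word.\<close>

lemma sum_listset_cuts:
  "(\<Sum>cs\<in>listset (map cuts ts).
      prod_list (map2 (\<lambda>c t. f (pruned c t)) cs ts) *\<^sub>R basis (map2 trunk cs ts)) = act_word f ts"
proof (induction ts)
  case (Cons t ts)
  have "act_word f (t # ts) =
      (\<Sum>c\<in>cuts t. f (pruned c t) *\<^sub>R lmap ((#) (trunk c t)) (act_word f ts))"
    by (simp add: act_tree_def linear_sum[OF linear_cat_left] linear_cmul[OF linear_cat_left] cat_basis)
  also have "\<dots> = (\<Sum>c\<in>cuts t. \<Sum>cs\<in>listset (map cuts ts).
      (f (pruned c t) * prod_list (map2 (\<lambda>c t. f (pruned c t)) cs ts)) *\<^sub>R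
        basis (trunk c t # map2 trunk cs ts))"
    by (simp add: Cons.IH[symmetric] linear_sum[OF linear_lmap] linear_cmul[OF linear_lmap]
        scaleR_sum_right)
  also have "\<dots> = (\<Sum>cs\<in>listset (map cuts (t # ts)).
      prod_list (map2 (\<lambda>c t. f (pruned c t)) cs (t # ts)) *\<^sub>R basis (map2 trunk cs (t # ts)))"
    by (simp only: list.map sum_listset_Cons) simp
  finally show ?case by simp
qed simp

lemma character_foldr_shuffle:
  assumes "forest_character f"
  shows "f (foldr shuffle xs (basis [])) = prod_list (map f xs)"
  by (induction xs) (simp_all add: forest_characterD[OF assms])

text \<open>Multiplicativity of \<open>f\<close> enters here: the pruned part is a shuffle product
  of the prefix and of the parts pruned from the remaining trees, and \<open>f\<close> turns it into
  a product of numbers that can be summed factor by factor.\<close>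

lemma act_forest_eq:
  assumes "forest_character f"
  shows "act_forest f \<omega> =
    (\<Sum>k\<le>length \<omega>. f (basis (take k \<omega>)) *\<^sub>R act_word f (drop k \<omega>))"
  unfolding act_forest_def sum_cuts_Node
proof (rule sum.cong[OF refl])
  fix k assume "k \<in> {..length \<omega>}"
  then have k: "k \<le> length \<omega>" by simp
  have 1: "f (pruned (node_cut k cs) (Node 0 \<omega>)) *\<^sub>R
        basis (branches (trunk (node_cut k cs) (Node 0 \<omega>))) =
      f (basis (take k \<omega>)) *\<^sub>R (prod_list (map2 (\<lambda>c t. f (pruned c t)) cs (drop k \<omega>)) *\<^sub>R
        basis (map2 trunk cs (drop k \<omega>)))"
    if "cs \<in> listset (map cuts (drop k \<omega>))" for cs
    by (simp only: trunk_node_cut[OF k listset_cuts_D[OF that]]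
        pruned_node_cut[OF k listset_cuts_D[OF that]] forest_characterD[OF assms]
        character_foldr_shuffle[OF assms] ptree.sel map_map comp_def case_prod_unfold
        scaleR_scaleR)
  show "(\<Sum>cs\<in>listset (map cuts (drop k \<omega>)). f (pruned (node_cut k cs) (Node 0 \<omega>)) *\<^sub>R
        basis (branches (trunk (node_cut k cs) (Node 0 \<omega>)))) =
      f (basis (take k \<omega>)) *\<^sub>R act_word f (drop k \<omega>)"
    by (simp only: 1 scaleR_sum_right[symmetric] sum_listset_cuts cong: sum.cong)
qed

lemma act_tree_Node: "act_tree f (Node i ts) = lmap (Node i) (act_forest f ts)"
proof -
  \<comment> \<open>Admissibility depends on the shape of the tree only, not on its
    decorations.\<close>
  have "cuts (Node i ts) = cuts (Node 0 ts)"
    by (simp add: cuts_def left_admissible_def edges_def leaves_def)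
  then show ?thesis
    by (simp add: act_tree_def act_forest_def linear_sum[OF linear_lmap] linear_cmul[OF linear_lmap])
qed

section \<open>Composition of two actions\<close>

lemma lin_ext_add: "lin_ext (\<lambda>a. c *\<^sub>R F a + H a) x = c *\<^sub>R lin_ext F x + lin_ext H x"
  by (simp add: lin_ext_def scaleR_add_right sum.distrib scaleR_sum_right mult.commute)

lemma linear_comp:
  assumes "linear g" "linear f"
  shows "linear (\<lambda>x. g (f x))"
  using linear_compose[OF assms(2,1)] by (simp add: comp_def)

lemma linear_scaleR_functional:
  fixes g :: "'a::real_vector \<Rightarrow> real"
  shows "linear g \<Longrightarrow> linear (\<lambda>y. g y *\<^sub>R v)"
  by (rule linearI) (simp_all add: linear_add linear_cmul scaleR_add_left)

text \<open>For a character \<open>g\<close>, taking \<open>G = g\<close> gives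
  \<open>act_forest g\<close>. The prefix has a functional of its own because the induction along a
  word absorbs the first letter into \<open>G\<close>; the result is still linear, but in general no
  longer a character.\<close>

definition word_split ::
  "(('d forest \<Rightarrow>\<^sub>0 real) \<Rightarrow> real) \<Rightarrow> (('d forest \<Rightarrow>\<^sub>0 real) \<Rightarrow> real) \<Rightarrow> 'd forest \<Rightarrow> ('d forest \<Rightarrow>\<^sub>0 real)"
  where "word_split G g \<omega> =
    (\<Sum>k\<le>length \<omega>. G (basis (take k \<omega>)) *\<^sub>R act_word g (drop k \<omega>))"

lemma word_split_Cons:
  "word_split G g (a # b) =
     G (basis []) *\<^sub>R act_word g (a # b) + word_split (\<lambda>x. G (lmap ((#) a) x)) g b"
  by (simp add: word_split_def sum.atMost_Suc_shift del: sum.atMost_Suc)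

text \<open>The action \<open>act_word f\<close> works letter by letter, so it commutes with
  splitting a word: acting and then splitting is the same as splitting and acting on both
  halves.\<close>

lemma word_split_act_word:
  assumes "linear G"
  shows "lin_ext (word_split G g) (act_word f \<omega>) =
    (\<Sum>k\<le>length \<omega>. G (act_word f (take k \<omega>)) *\<^sub>R lin_ext (act_word g) (act_word f (drop k \<omega>)))"
  using assms
proof (induction \<omega> arbitrary: G)
  case Nil
  then show ?case by (simp add: word_split_def)
next
  case (Cons t ts)
  let ?W = "lin_ext (act_word g)"
  \<comment> \<open>The image of the first tree is replaced by an arbitrary \<open>x\<close>. Both
    sides are linear in \<open>x\<close>, and for a basis vector the induction hypothesis applies to
    the functional that has absorbed this letter.\<close>
  have "lin_ext (word_split G g) (cat x (act_word f ts)) =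
      G (basis []) *\<^sub>R ?W (cat x (act_word f ts)) +
      (\<Sum>k\<le>length ts. G (cat x (act_word f (take k ts))) *\<^sub>R ?W (act_word f (drop k ts)))" for x
  proof (rule linear_eq_on_basis[of "\<lambda>x. lin_ext (word_split G g) (cat x (act_word f ts))"])
    show "linear (\<lambda>x. lin_ext (word_split G g) (cat x (act_word f ts)))"
      by (intro linear_comp[OF linear_lin_ext linear_cat_left])
    show "linear (\<lambda>x. G (basis []) *\<^sub>R ?W (cat x (act_word f ts)) +
      (\<Sum>k\<le>length ts. G (cat x (act_word f (take k ts))) *\<^sub>R ?W (act_word f (drop k ts))))"
      by (intro linear_compose_add linear_compose_scale_right linear_compose_sum ballI
          linear_comp[OF linear_lin_ext linear_cat_left] linear_scaleR_functional
          linear_comp[OF Cons.prems linear_cat_left])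
    fix a
    have lin: "linear (\<lambda>x. G (lmap ((#) a) x))"
      by (rule linear_comp[OF Cons.prems linear_lmap])
    show "lin_ext (word_split G g) (cat (basis a) (act_word f ts)) =
        G (basis []) *\<^sub>R ?W (cat (basis a) (act_word f ts)) +
        (\<Sum>k\<le>length ts. G (cat (basis a) (act_word f (take k ts))) *\<^sub>R ?W (act_word f (drop k ts)))"
      unfolding cat_basis lin_ext_lmap word_split_Cons lin_ext_add Cons.IH[OF lin] ..
  qed
  then show ?case
    by (simp add: sum.atMost_Suc_shift del: sum.atMost_Suc)
qed

lemma lin_ext_act_word_cat:
  "lin_ext (act_word g) (cat x y) = cat (lin_ext (act_tree g) x) (lin_ext (act_word g) y)"
proof (rule linear_eq_on_basis[of "\<lambda>x. lin_ext (act_word g) (cat x y)"])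
  fix a
  show "lin_ext (act_word g) (cat (basis a) y) =
      cat (lin_ext (act_tree g) (basis a)) (lin_ext (act_word g) y)"
    by (simp add: cat_basis lin_ext_lmap linear_lin_ext_comp[OF linear_cat_right])
qed (intro linear_comp[OF linear_lin_ext linear_cat_left] linear_comp[OF linear_cat_left linear_lin_ext])+

lemma convolution_basis:
  assumes f: "linear f" and g: "linear g"
  shows "Defs.convolution f g (basis \<omega>) = g (act_forest f \<omega>)"
proof -
  have "tensor_lift (\<lambda>y z. f y * g z) (tensor x (basis b)) = f x * g (basis b)" for x b
    by (rule tensor_lift_tensor_basis)
      (use linear_scaleR_functional[OF f, of "g (basis b)"] in simp)
  then show ?thesis
    by (simp add: Defs.convolution_def Delta_MKW_def Delta_MKW_forest_def act_forest_def cuts_def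
        linear_sum[OF linear_tensor_lift] linear_sum[OF g] linear_cmul[OF g])
qed

text \<open>The two actions split off prefixes of lengths \<open>j\<close> and \<open>k\<close> one
  after the other. For a fixed total length the two evaluations add up to the convolution
  \<open>h\<close> on the joint prefix. The law for the remaining letters is the assumption
  \<open>word\<close>, so that the lemma can serve inside an induction on trees.\<close>

lemma act_forest_comp_aux:
  assumes f: "forest_character f" and g: "forest_character g" and h: "forest_character h"
    and conv: "\<And>\<omega>. h (basis \<omega>) = g (act_forest f \<omega>)"
    and word: "\<And>k. lin_ext (act_word g) (act_word f (drop k \<omega>)) = act_word h (drop k \<omega>)"
  shows "lin_ext (act_forest g) (act_forest f \<omega>) = act_forest h \<omega>"
proof -
  define n where "n = length \<omega>"
  let ?W = "lin_ext (act_word g)"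
  let ?T = "\<lambda>j k. (f (basis (take j \<omega>)) * g (act_word f (take k (drop j \<omega>)))) *\<^sub>R
    act_word h (drop (j + k) \<omega>)"
  have split: "act_forest g = word_split g g"
    by (simp add: fun_eq_iff act_forest_eq[OF g] word_split_def)
  have "lin_ext (act_forest g) (act_forest f \<omega>) =
      (\<Sum>j\<le>n. f (basis (take j \<omega>)) *\<^sub>R lin_ext (act_forest g) (act_word f (drop j \<omega>)))"
    by (simp add: act_forest_eq[OF f] n_def linear_sum[OF linear_lin_ext] linear_cmul[OF linear_lin_ext])
  also have "\<dots> = (\<Sum>j\<le>n. \<Sum>k\<le>n - j. ?T j k)"
    by (simp add: split word_split_act_word[OF forest_characterD(1)[OF g]] n_def word
        scaleR_sum_right add.commute)
  also have "\<dots> = (\<Sum>(j, k)\<in>{(j, k). j + k \<le> n}. ?T j k)"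
    by (subst sum.Sigma) (auto intro!: sum.cong)
  \<comment> \<open>The sum is regrouped by the total length \<open>m = j + k\<close> of what both
    actions remove.\<close>
  also have "\<dots> = (\<Sum>m\<le>n. \<Sum>j\<le>m. ?T j (m - j))"
    by (rule sum.triangle_reindex_eq)
  also have "\<dots> = (\<Sum>m\<le>n. h (basis (take m \<omega>)) *\<^sub>R act_word h (drop m \<omega>))"
  proof (rule sum.cong[OF refl])
    fix m assume "m \<in> {..n}"
    then have m: "m \<le> length \<omega>" by (simp add: n_def)
    \<comment> \<open>This is \<open>conv\<close> on the prefix of length \<open>m\<close>, with the
      action of \<open>f\<close> on it expanded by its recursion.\<close>
    have "h (basis (take m \<omega>)) =
        (\<Sum>j\<le>m. f (basis (take j \<omega>)) * g (act_word f (take (m - j) (drop j \<omega>))))"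
      using m by (simp add: conv act_forest_eq[OF f] linear_sum[OF forest_characterD(1)[OF g]]
          linear_cmul[OF forest_characterD(1)[OF g]] drop_take min_def)
    then show "(\<Sum>j\<le>m. ?T j (m - j)) = h (basis (take m \<omega>)) *\<^sub>R act_word h (drop m \<omega>)"
      by (simp add: scaleR_sum_left)
  qed
  also have "\<dots> = act_forest h \<omega>"
    by (simp add: act_forest_eq[OF h] n_def)
  finally show ?thesis .
qed

text \<open>Trees and words are settled in one structural induction: the hypothesis for the branches
  gives the law letter by letter on words, and the forest lemma carries it back to the node.\<close>

lemma act_tree_comp:
  assumes f: "forest_character f" and g: "forest_character g" and h: "forest_character h"
    and conv: "\<And>\<omega>. h (basis \<omega>) = g (act_forest f \<omega>)"
  shows "lin_ext (act_tree g) (act_tree f t) = act_tree h t"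
proof (induction t)
  case (Node i ts)
  have word: "lin_ext (act_word g) (act_word f us) = act_word h us" if "set us \<subseteq> set ts" for us
    using that by (induction us) (auto simp: lin_ext_act_word_cat Node.IH)
  have "lin_ext (act_tree g) (act_tree f (Node i ts)) =
      lmap (Node i) (lin_ext (act_forest g) (act_forest f ts))"
    by (simp add: act_tree_Node lin_ext_lmap linear_lin_ext_comp[OF linear_lmap])
  also have "lin_ext (act_forest g) (act_forest f ts) = act_forest h ts"
    by (rule act_forest_comp_aux[OF f g h conv word]) (rule set_drop_subset)
  finally show ?case by (simp add: act_tree_Node)
qed

text \<open>The first term comes from the cut of the only root edge, the second from the cuts inside
  \<open>t\<close>. The coaction on trees with a decorated edge at the root drops the first
  one.\<close>

lemma act_forest_singleton:
  assumes "forest_character f"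
  shows "act_forest f [t] = f (basis [t]) *\<^sub>R basis [] + lmap (\<lambda>t. [t]) (act_tree f t)"
proof -
  have "cat (act_tree f t) (basis []) = lmap (\<lambda>t. [t]) (act_tree f t)"
    by (rule linear_eq_on_basis[OF linear_cat_left linear_lmap]) (simp add: cat_basis)
  then show ?thesis
    by (simp add: act_forest_eq[OF assms] forest_characterD[OF assms])
qed

section \<open>The structure group\<close>

lemma phi_Node_0: "phi (Node 0 \<omega>) = incl (Bplus_phi \<omega>)"
proof -
  have "Rep_pbtree (phi (Node 0 \<omega>)) = Rep_pbtree (incl (Bplus_phi \<omega>))"
    by (simp add: Rep_phi Bplus_phi_def Rep_Bplus)
  then show ?thesis by (simp add: Rep_pbtree_inject)
qed

lemma root_undecorated_phi: "root_undecorated (phi (Node i \<omega>)) \<longleftrightarrow> i = 0"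
  by (auto simp: root_undecorated_def Rep_phi)

lemma Bplus_phi_simps: "Bplus [] = Bplus_phi []" "Bplus [phi t] = Bplus_phi [t]"
  by (simp_all add: Bplus_phi_def)

lemma linear_Gamma_of: "linear (Gamma_of g)"
  unfolding Gamma_of_def Delta_plus_def by (rule linear_comp[OF linear_tensor_lift linear_lin_ext])

text \<open>The map \<open>h\<close> on the second factor lets one computation cover both clauses of
  the coaction: it is the identity for trees without a decorated edge at the root, and
  \<open>Bminus\<close> for the others.\<close>

lemma tensor_lift_Delta_plus:
  assumes g: "linear g"
  shows "tensor_lift (\<lambda>y z. g y *\<^sub>R lmap h z) (Delta_plus (basis (incl (Bplus_phi \<omega>)))) =
    lmap (\<lambda>\<sigma>. h (incl (Bplus_phi \<sigma>))) (act_forest (\<lambda>x. g (lmap Bplus_phi x)) \<omega>)"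
proof -
  have 1: "tensor_lift (\<lambda>y z. g y *\<^sub>R lmap h z) (tensor x (basis b)) = g x *\<^sub>R lmap h (basis b)" for x b
    by (rule tensor_lift_tensor_basis) (rule linear_scaleR_functional[OF g])
  show ?thesis
    by (simp add: Delta_plus_Bplus_phi Delta_MKW_def Delta_MKW_forest_def act_forest_def cuts_def
        linear_sum[OF linear_lmap] linear_sum[OF linear_tensor_lift] linear_cmul[OF linear_lmap]
        lmap_map_prod_tensor_basis 1)
qed

lemma Gamma_of_phi:
  assumes g: "linear g" and f: "forest_character (\<lambda>x. g (lmap Bplus_phi x))" (is "forest_character ?f")
  shows "Gamma_of g (basis (phi t)) = lmap phi (act_tree ?f t)"
proof (cases t)
  case (Node i \<omega>)
  show ?thesis
  proof (cases "i = 0")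
    case True
    then show ?thesis
      using tensor_lift_Delta_plus[OF g, of "\<lambda>a. a" \<omega>] Node
      by (simp add: lmap_id phi_Node_0 Gamma_of_def act_tree_Node lmap_lmap)
  next
    case False
    let ?\<tau> = "phi t"
    have nr: "\<not> root_undecorated ?\<tau>" using False Node by (simp add: root_undecorated_phi)
    have lift: "tensor_lift (\<lambda>y z. g y *\<^sub>R z) (lmap (map_prod id h) x) =
        tensor_lift (\<lambda>y z. g y *\<^sub>R lmap h z) x" for h x
      by (simp add: tensor_lift_def lin_ext_lmap case_prod_unfold)
    \<comment> \<open>Expanding the difference by linearity applies \<open>Bminus\<close> to
      \<open>bullet\<close>, which lies outside the range of trees on which it is meaningful. The
      resulting unspecified value occurs once more in the action on \<open>[t]\<close>, and the two
      cancel.\<close>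
    have "Gamma_of g (basis ?\<tau>) =
        tensor_lift (\<lambda>y z. g y *\<^sub>R lmap Bminus z) (Delta_plus (basis (incl (Bplus_phi [t])))) -
        g (basis (Bplus_phi [t])) *\<^sub>R basis (Bminus (incl (Bplus_phi [])))"
      by (simp add: Gamma_of_def Delta_plus_decorated[OF nr] lift linear_diff[OF linear_tensor_lift]
          Bplus_phi_simps bullet_eq(2))
    also have "\<dots> = lmap (\<lambda>\<sigma>. Bminus (incl (Bplus_phi \<sigma>))) (act_forest ?f [t]) -
        ?f (basis [t]) *\<^sub>R basis (Bminus (incl (Bplus_phi [])))"
      by (simp add: tensor_lift_Delta_plus[OF g])
    also have "\<dots> = lmap (\<lambda>t. Bminus (incl (Bplus [phi t]))) (act_tree ?f t)"
      by (simp add: act_forest_singleton[OF f] linear_add[OF linear_lmap] linear_cmul[OF linear_lmap]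
          lmap_lmap Bplus_phi_simps)
    finally show ?thesis by simp
  qed
qed

lemma is_character_lmap_inv:
  assumes "forest_character f"
  shows "is_character (\<lambda>x. f (lmap Bplus_phi_inv x))"
  unfolding is_character_def
  by (simp add: Bplus_phi_simps forest_characterD[OF assms] tree_product_def lmap_lmap lmap_id
      linear_comp[OF forest_characterD(1)[OF assms] linear_lmap])

text \<open>Since the root stays in the trunk, the forests cut off from \<open>t\<close> have fewer
  than \<open>num_vertices t\<close> vertices. The bound \<open>n\<close> is explicit so that the
  lemma applies within an induction in which \<open>f\<close> is known to vanish on smaller forests
  only.\<close>

lemma act_tree_trivial:
  fixes f :: "('d::zero forest \<Rightarrow>\<^sub>0 real) \<Rightarrow> real"
  assumes f: "forest_character f" and 0: "\<And>\<omega>. \<omega> \<noteq> [] \<Longrightarrow> forest_size \<omega> < n \<Longrightarrow> f (basis \<omega>) = 0"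
    and "num_vertices t \<le> n"
  shows "act_tree f t = basis t"
  using assms(3)
proof (induction t)
  case (Node i ts)
  have sz: "forest_size ts < n" using Node.prems by (simp add: forest_size_def)
  have t: "num_vertices t \<le> n" if "t \<in> set ts" for t
    using member_le_sum_list[of "num_vertices t" "map num_vertices ts"] that sz
    by (force simp: forest_size_def)
  have word: "act_word f us = basis us" if "set us \<subseteq> set ts" for us
    using that by (induction us) (auto simp: Node.IH t cat_basis)
  have le: "forest_size (take k ts) \<le> forest_size ts" for k
    using sum_list_append[of "map num_vertices (take k ts)" "map num_vertices (drop k ts)"]
    by (simp add: forest_size_def flip: map_append)
  have "f (basis (take k ts)) *\<^sub>R act_word f (drop k ts) = (if k = 0 then basis ts else 0)"
    if "k \<le> length ts" for k
    using that 0[of "take k ts"] le[of k] sz word[of ts] forest_characterD[OF f]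
    by (cases "ts = []") auto
  then have "act_forest f ts = (\<Sum>k\<le>length ts. if k = 0 then basis ts else 0)"
    unfolding act_forest_eq[OF f] by (intro sum.cong) auto
  then have "act_forest f ts = basis ts" by simp
  then show ?case by (simp add: act_tree_Node)
qed

text \<open>If \<open>f\<close> vanishes on smaller nonempty forests, only the empty and the full
  prefix survive in the action on \<open>\<omega>\<close>. Each contributes
  \<open>f (basis \<omega>)\<close> to the convolution square, whence this number equals its
  double.\<close>

lemma idempotent_character:
  assumes f: "forest_character f" and conv: "\<And>\<omega>. f (basis \<omega>) = f (act_forest f \<omega>)"
  shows "\<omega> \<noteq> [] \<Longrightarrow> f (basis \<omega>) = 0"
proof (induction "forest_size \<omega>" arbitrary: \<omega> rule: less_induct)
  case less
  have le: "forest_size (take k \<omega>) < forest_size \<omega>" if "k < length \<omega>" for k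
  proof -
    have "drop k \<omega> \<noteq> []" using that by simp
    then have "forest_size (drop k \<omega>) > 0"
      by (cases "drop k \<omega>"; cases "hd (drop k \<omega>)") (auto simp: forest_size_def)
    moreover have "forest_size \<omega> = forest_size (take k \<omega>) + forest_size (drop k \<omega>)"
      unfolding forest_size_def by (simp flip: sum_list_append map_append)
    ultimately show ?thesis by simp
  qed
  have t: "num_vertices t \<le> forest_size \<omega>" if "t \<in> set \<omega>" for t
    using member_le_sum_list[of "num_vertices t" "map num_vertices \<omega>"] that
    by (force simp: forest_size_def)
  \<comment> \<open>A single tree may fill the whole of \<open>\<omega>\<close>; the bound on
    \<open>num_vertices t\<close> is non-strict for this reason.\<close>
  have tree: "act_tree f t = basis t" if "t \<in> set \<omega>" for t
    by (rule act_tree_trivial[OF f _ t[OF that]]) (use less in auto)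
  have word: "act_word f us = basis us" if "set us \<subseteq> set \<omega>" for us
    using that by (induction us) (auto simp: tree cat_basis)
  have "f (basis (take k \<omega>)) *\<^sub>R act_word f (drop k \<omega>) =
      (if k = 0 then basis \<omega> else 0) + (if k = length \<omega> then f (basis \<omega>) *\<^sub>R basis [] else 0)"
    if "k \<le> length \<omega>" for k
    using that less.hyps[of "take k \<omega>"] le[of k] word[of \<omega>] forest_characterD[OF f] less.prems by auto
  then have "act_forest f \<omega> = (\<Sum>k\<le>length \<omega>.
      (if k = 0 then basis \<omega> else 0) + (if k = length \<omega> then f (basis \<omega>) *\<^sub>R basis [] else 0))"
    unfolding act_forest_eq[OF f] by (intro sum.cong) auto
  then have "act_forest f \<omega> = basis \<omega> + f (basis \<omega>) *\<^sub>R basis []"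
    by (simp add: sum.distrib)
  then have "f (act_forest f \<omega>) = f (basis \<omega>) + f (basis \<omega>)"
    by (simp add: forest_characterD[OF f] linear_add linear_cmul)
  with conv[of \<omega>] show ?case by simp
qed

section \<open>Distributions of finite order\<close>

lemma schwartz_differentiable: "(deriv ^^ m) (schwartz_fun f) field_differentiable at x"
  using schwartz_fun[of f] by auto

lemma schwartz_has_derivative:
  "(schwartz_fun f has_real_derivative deriv (schwartz_fun f) x) (at x within S)"
  using schwartz_differentiable[of 0 f x] DERIV_deriv_iff_field_differentiable
  by (auto intro: has_field_derivative_at_within)

lemma continuous_on_schwartz: "continuous_on S ((deriv ^^ m) (schwartz_fun f))"
  by (intro continuous_at_imp_continuous_on ballI field_differentiable_imp_continuous_at
      schwartz_differentiable)

lemma schwartz_seminorm_upper: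
  "\<bar>x ^ k * (deriv ^^ m) (schwartz_fun f) x\<bar> \<le> schwartz_seminorm k m f"
proof -
  have "bounded (range (\<lambda>x. x ^ k * (deriv ^^ m) (schwartz_fun f) x))"
    using schwartz_fun[of f] by auto
  then have "bdd_above (range (\<lambda>x. \<bar>x ^ k * (deriv ^^ m) (schwartz_fun f) x\<bar>))"
    unfolding bounded_iff by (auto intro: bdd_aboveI2)
  then show ?thesis unfolding schwartz_seminorm_def by (rule cSUP_upper[OF UNIV_I])
qed

lemma schwartz_seminorm_nonneg: "0 \<le> schwartz_seminorm k m f"
  using schwartz_seminorm_upper[of 0 k m f] by linarith

lemma schwartz_fun_deriv: "schwartz_fun (schwartz_deriv f) = deriv (schwartz_fun f)"
  by (rule schwartz_deriv.rep_eq)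

lemma schwartz_seminorm_deriv:
  "schwartz_seminorm k m (schwartz_deriv f) = schwartz_seminorm k (Suc m) f"
  by (simp add: schwartz_seminorm_def schwartz_fun_deriv funpow_swap1)

lemma linear_schwartz_deriv: "linear schwartz_deriv"
proof (rule linearI)
  fix f g :: schwartz and c :: real
  show "schwartz_deriv (f + g) = schwartz_deriv f + schwartz_deriv g"
    using schwartz_differentiable[of 0]
    by (auto simp: schwartz_fun_inject[symmetric] schwartz_fun_deriv plus_schwartz.rep_eq fun_eq_iff
        intro!: deriv_add)
  show "schwartz_deriv (c *\<^sub>R f) = c *\<^sub>R schwartz_deriv f"
    using schwartz_differentiable[of 0]
    by (auto simp: schwartz_fun_inject[symmetric] schwartz_fun_deriv scaleR_schwartz.rep_eq fun_eq_iff
        intro!: deriv_cmult)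
qed

definition seminorm_sum :: "nat \<Rightarrow> schwartz \<Rightarrow> real" where
  "seminorm_sum N f = (\<Sum>k\<le>N. \<Sum>m\<le>N. schwartz_seminorm k m f)"

lemma seminorm_sum_mono: "N \<le> M \<Longrightarrow> seminorm_sum N f \<le> seminorm_sum M f"
  unfolding seminorm_sum_def
  by (rule order_trans[OF sum_mono sum_mono2])
    (auto intro!: sum_mono2 sum_nonneg schwartz_seminorm_nonneg)

lemma schwartz_seminorm_le_sum: "k \<le> N \<Longrightarrow> m \<le> N \<Longrightarrow> schwartz_seminorm k m f \<le> seminorm_sum N f"
  unfolding seminorm_sum_def
  by (rule order_trans[OF member_le_sum[of m "{..N}"] member_le_sum[of k "{..N}"]])
    (auto intro!: sum_nonneg schwartz_seminorm_nonneg)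

lemma seminorm_sum_deriv: "seminorm_sum N (schwartz_deriv f) \<le> seminorm_sum (Suc N) f"
proof -
  have "seminorm_sum N (schwartz_deriv f) \<le> (\<Sum>k\<le>N. \<Sum>m\<le>Suc N. schwartz_seminorm k m f)"
    unfolding seminorm_sum_def schwartz_seminorm_deriv
    by (intro sum_mono) (simp add: sum.atMost_Suc_shift schwartz_seminorm_nonneg del: sum.atMost_Suc)
  also have "\<dots> \<le> seminorm_sum (Suc N) f"
    unfolding seminorm_sum_def
    by (intro sum_mono2) (auto intro!: sum_nonneg schwartz_seminorm_nonneg simp del: sum.atMost_Suc)
  finally show ?thesis .
qed

text \<open>Continuity in quantitative form. It passes easily to sums and derivatives, and it gives
  the uniform bounds on bounded sets that the strong dual topology asks for.\<close>

definition seminorm_bounded :: "(schwartz \<Rightarrow> real) \<Rightarrow> bool" where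
  "seminorm_bounded T \<longleftrightarrow> linear T \<and> (\<exists>N K. K \<ge> 0 \<and> (\<forall>f. \<bar>T f\<bar> \<le> K * seminorm_sum N f))"

lemma seminorm_bounded_tempered:
  assumes "seminorm_bounded T"
  shows "T \<in> tempered_distributions"
proof -
  obtain N K where lin: "linear T" and K: "K \<ge> 0" and T: "\<And>f. \<bar>T f\<bar> \<le> K * seminorm_sum N f"
    using assms by (auto simp: seminorm_bounded_def)
  have "open (T -` B)" if "open B" for B
    unfolding open_schwartz_def
  proof
    fix f assume "f \<in> T -` B"
    then obtain \<epsilon> where \<epsilon>: "\<epsilon> > 0" "\<And>y. dist y (T f) < \<epsilon> \<Longrightarrow> y \<in> B"
      using \<open>open B\<close> by (auto simp: open_dist)
    \<comment> \<open>The double sum has \<open>(N + 1)^2\<close> terms. The 1 added to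
      \<open>M\<close> in \<open>e\<close> keeps the divisor positive when
      \<open>K = 0\<close>.\<close>
    define M where "M = K * real (Suc N * Suc N)"
    have M: "M \<ge> 0" using K by (simp add: M_def)
    define e where "e = \<epsilon> / (M + 1)"
    have e: "e > 0" using \<epsilon> M by (simp add: e_def)
    have "g \<in> T -` B" if g: "\<forall>k\<le>N. \<forall>m\<le>N. schwartz_seminorm k m (g - f) < e" for g
    proof -
      have "seminorm_sum N (g - f) \<le> (\<Sum>k\<le>N. \<Sum>m\<le>N. e)"
        unfolding seminorm_sum_def using g by (intro sum_mono) (auto intro: less_imp_le)
      then have "seminorm_sum N (g - f) \<le> real (Suc N * Suc N) * e" by (simp add: algebra_simps)
      then have "\<bar>T (g - f)\<bar> \<le> M * e"
        using T[of "g - f"] K by (simp add: M_def mult.assoc) (meson mult_left_mono order_trans)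
      also have "\<dots> < \<epsilon>" using \<epsilon> M by (simp add: e_def field_simps)
      finally show ?thesis
        using \<epsilon>(2)[of "T g"] by (simp add: dist_real_def linear_diff[OF lin])
    qed
    with e show "\<exists>N. \<exists>e>0. \<forall>g. (\<forall>k\<le>N. \<forall>m\<le>N. schwartz_seminorm k m (g - f) < e) \<longrightarrow> g \<in> T -` B"
      by blast
  qed
  then have "continuous_on UNIV T"
    by (simp add: continuous_on_open_vimage)
  with lin show ?thesis by (simp add: tempered_distributions_def)
qed

lemma seminorm_bounded_on_bounded_set:
  assumes "seminorm_bounded T" "schwartz_bounded B"
  obtains M where "\<And>f. f \<in> B \<Longrightarrow> \<bar>T f\<bar> \<le> M"
proof -
  obtain N K where K: "K \<ge> 0" and T: "\<And>f. \<bar>T f\<bar> \<le> K * seminorm_sum N f"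
    using assms(1) by (auto simp: seminorm_bounded_def)
  obtain b where b: "\<And>k m f. f \<in> B \<Longrightarrow> schwartz_seminorm k m f \<le> b k m"
    using assms(2) unfolding schwartz_bounded_def bdd_above_def by (metis image_eqI)
  have "\<bar>T f\<bar> \<le> K * (\<Sum>k\<le>N. \<Sum>m\<le>N. b k m)" if "f \<in> B" for f
    using K b[OF that] by (intro order_trans[OF T] mult_left_mono) (auto simp: seminorm_sum_def intro!: sum_mono)
  then show thesis by (rule that)
qed

lemma seminorm_bounded_zero: "seminorm_bounded (\<lambda>f. 0)"
  unfolding seminorm_bounded_def by (auto intro!: linearI exI[of _ 0])

lemma seminorm_bounded_add:
  assumes "seminorm_bounded S" "seminorm_bounded T"
  shows "seminorm_bounded (\<lambda>f. S f + T f)"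
proof -
  obtain N K where S: "linear S" "K \<ge> 0" "\<And>f. \<bar>S f\<bar> \<le> K * seminorm_sum N f"
    using assms(1) by (auto simp: seminorm_bounded_def)
  obtain M L where T: "linear T" "L \<ge> 0" "\<And>f. \<bar>T f\<bar> \<le> L * seminorm_sum M f"
    using assms(2) by (auto simp: seminorm_bounded_def)
  have "\<bar>S f + T f\<bar> \<le> (K + L) * seminorm_sum (max N M) f" for f
  proof -
    have "\<bar>S f + T f\<bar> \<le> K * seminorm_sum N f + L * seminorm_sum M f"
      using S(3)[of f] T(3)[of f] by linarith
    also have "\<dots> \<le> K * seminorm_sum (max N M) f + L * seminorm_sum (max N M) f"
      using S(2) T(2) by (intro add_mono mult_left_mono seminorm_sum_mono) auto
    finally show ?thesis by (simp add: distrib_right)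
  qed
  then show ?thesis
    using S(1,2) T(1,2) linear_compose_add[OF S(1) T(1)] unfolding seminorm_bounded_def
    by (intro conjI exI[of _ "max N M"] exI[of _ "K + L"]) auto
qed

lemma seminorm_bounded_scale:
  assumes "seminorm_bounded T"
  shows "seminorm_bounded (\<lambda>f. c *\<^sub>R T f)"
proof -
  obtain N K where T: "linear T" "K \<ge> 0" "\<And>f. \<bar>T f\<bar> \<le> K * seminorm_sum N f"
    using assms by (auto simp: seminorm_bounded_def)
  have "\<bar>c *\<^sub>R T f\<bar> \<le> (\<bar>c\<bar> * K) * seminorm_sum N f" for f
    using mult_left_mono[OF T(3)[of f], of "\<bar>c\<bar>"] by (simp add: abs_mult mult.assoc)
  then show ?thesis
    using T(2) linear_compose_scale_right[OF T(1), of c] unfolding seminorm_bounded_def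
    by (intro conjI exI[of _ N] exI[of _ "\<bar>c\<bar> * K"]) auto
qed

lemma seminorm_bounded_lin_ext:
  assumes "\<And>a. seminorm_bounded (F a)"
  shows "seminorm_bounded (\<lambda>f. lin_ext (\<lambda>a. F a f) x)"
proof -
  have "seminorm_bounded (\<lambda>f. \<Sum>a\<in>S. c a *\<^sub>R F a f)" if "finite S" for S and c :: "'a \<Rightarrow> real"
    using that by (induction S)
      (simp_all add: seminorm_bounded_zero seminorm_bounded_add seminorm_bounded_scale assms
        del: real_scaleR_def)
  then show ?thesis by (simp add: lin_ext_def)
qed

lemma seminorm_bounded_deriv:
  assumes "seminorm_bounded T"
  shows "seminorm_bounded (distribution_deriv T)"
proof -
  obtain N K where T: "linear T" "K \<ge> 0" "\<And>f. \<bar>T f\<bar> \<le> K * seminorm_sum N f"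
    using assms by (auto simp: seminorm_bounded_def)
  have "\<bar>distribution_deriv T f\<bar> \<le> K * seminorm_sum (Suc N) f" for f
    using T(3)[of "schwartz_deriv f"] mult_left_mono[OF seminorm_sum_deriv T(2), of N f]
    by (simp add: distribution_deriv_def)
  moreover have "linear (distribution_deriv T)"
    unfolding distribution_deriv_def
    by (intro linear_compose_neg linear_comp[OF T(1) linear_schwartz_deriv])
  ultimately show ?thesis using T(2) unfolding seminorm_bounded_def by blast
qed

section \<open>Functions of polynomial growth as distributions\<close>

definition poly_growth :: "(real \<Rightarrow> real) \<Rightarrow> bool" where
  "poly_growth h \<longleftrightarrow> (\<exists>C d. C \<ge> 0 \<and> (\<forall>t. \<bar>h t\<bar> \<le> C * (1 + \<bar>t\<bar>) ^ d))"

lemma poly_growth_const: "poly_growth (\<lambda>_. c)"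
  unfolding poly_growth_def by (rule exI[of _ "\<bar>c\<bar>"], rule exI[of _ 0]) simp

lemma integrable_inverse_one_plus_square: "integrable lborel (\<lambda>x::real. inverse (1 + x\<^sup>2))"
  using integrable_inverse_1_plus_square by (simp add: set_integrable_def)

text \<open>Two extra powers of \<open>1 + \<bar>t\<bar>\<close> pay for the integrable majorant.
  The constant collects \<open>2 ^ (d + 2)\<close> from comparing
  \<open>(1 + \<bar>t\<bar>) ^ (d + 2)\<close> with \<open>1 + \<bar>t\<bar> ^ (d + 2)\<close>, and
  a factor 2 because two seminorms, with \<open>k = 0\<close> and \<open>k = d + 2\<close>, are each
  estimated by the whole sum.\<close>

lemma schwartz_poly_bound:
  "(1 + \<bar>t\<bar>) ^ d * \<bar>schwartz_fun f t\<bar> \<le> (2 * 2 ^ (d + 2) * seminorm_sum (d + 2) f) * inverse (1 + t\<^sup>2)"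
proof -
  have le: "(1 + \<bar>t\<bar>) ^ n \<le> 2 ^ n * (1 + \<bar>t\<bar> ^ n)" for n
  proof (cases "\<bar>t\<bar> \<le> 1")
    case True
    then have "(1 + \<bar>t\<bar>) ^ n \<le> 2 ^ n" by (intro power_mono) auto
    also have "\<dots> \<le> 2 ^ n * (1 + \<bar>t\<bar> ^ n)" by simp
    finally show ?thesis .
  next
    case False
    then have "(1 + \<bar>t\<bar>) ^ n \<le> (2 * \<bar>t\<bar>) ^ n" by (intro power_mono) auto
    also have "\<dots> \<le> 2 ^ n * (1 + \<bar>t\<bar> ^ n)" by (simp add: power_mult_distrib)
    finally show ?thesis .
  qed
  have "1 + t\<^sup>2 \<le> (1 + \<bar>t\<bar>)\<^sup>2" by (simp add: power2_sum)
  then have "(1 + \<bar>t\<bar>) ^ d * (1 + t\<^sup>2) \<le> (1 + \<bar>t\<bar>) ^ (d + 2)"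
    unfolding power_add by (rule mult_left_mono) simp
  also have "\<dots> \<le> 2 ^ (d + 2) * (1 + \<bar>t\<bar> ^ (d + 2))" by (rule le)
  finally have "(1 + \<bar>t\<bar>) ^ d * (1 + t\<^sup>2) * \<bar>schwartz_fun f t\<bar> \<le>
      2 ^ (d + 2) * (1 + \<bar>t\<bar> ^ (d + 2)) * \<bar>schwartz_fun f t\<bar>"
    by (rule mult_right_mono) simp
  also have "\<dots> = 2 ^ (d + 2) * (\<bar>t ^ 0 * (deriv ^^ 0) (schwartz_fun f) t\<bar> +
      \<bar>t ^ (d + 2) * (deriv ^^ 0) (schwartz_fun f) t\<bar>)"
    by (simp add: abs_mult power_abs distrib_right distrib_left mult.assoc)
  also have "\<dots> \<le> 2 ^ (d + 2) * (seminorm_sum (d + 2) f + seminorm_sum (d + 2) f)"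
    by (intro mult_left_mono add_mono order_trans[OF schwartz_seminorm_upper schwartz_seminorm_le_sum])
      auto
  finally have "(1 + \<bar>t\<bar>) ^ d * \<bar>schwartz_fun f t\<bar> * (1 + t\<^sup>2) \<le> 2 * 2 ^ (d + 2) * seminorm_sum (d + 2) f"
    by (simp add: mult_ac)
  moreover have "1 + t\<^sup>2 > 0" by (simp add: add_pos_nonneg)
  ultimately show ?thesis by (simp add: pos_le_divide_eq flip: divide_inverse)
qed

lemma
  assumes meas: "h \<in> borel_measurable borel" and bound: "\<And>t. \<bar>h t\<bar> \<le> C * (1 + \<bar>t\<bar>) ^ d"
  shows integrable_mult_schwartz_aux: "integrable lborel (\<lambda>t. h t * schwartz_fun f t)"
    and fun_distribution_bound: "\<bar>fun_distribution h f\<bar> \<le>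
      (C * (2 * 2 ^ (d + 2)) * (LINT t|lborel. inverse (1 + t\<^sup>2))) * seminorm_sum (d + 2) f"
proof -
  let ?B = "\<lambda>t. (C * (2 * 2 ^ (d + 2)) * seminorm_sum (d + 2) f) * inverse (1 + t\<^sup>2)"
  have C: "C \<ge> 0" using bound[of 0] by simp
  have le: "\<bar>h t * schwartz_fun f t\<bar> \<le> ?B t" for t
  proof -
    have "\<bar>h t * schwartz_fun f t\<bar> \<le> C * ((1 + \<bar>t\<bar>) ^ d * \<bar>schwartz_fun f t\<bar>)"
      using mult_right_mono[OF bound[of t], of "\<bar>schwartz_fun f t\<bar>"] by (simp add: abs_mult mult.assoc)
    also have "\<dots> \<le> C * ((2 * 2 ^ (d + 2) * seminorm_sum (d + 2) f) * inverse (1 + t\<^sup>2))"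
      by (rule mult_left_mono[OF schwartz_poly_bound C])
    finally show ?thesis by (simp add: mult.assoc)
  qed
  have intB: "integrable lborel ?B"
    by (rule integrable_mult_right) (rule integrable_inverse_one_plus_square)
  have "schwartz_fun f \<in> borel_measurable borel"
    using continuous_on_schwartz[of UNIV 0 f] by (intro borel_measurable_continuous_onI) simp
  with meas have m: "(\<lambda>t. h t * schwartz_fun f t) \<in> borel_measurable lborel" by simp
  show int: "integrable lborel (\<lambda>t. h t * schwartz_fun f t)"
    by (rule Bochner_Integration.integrable_bound[OF intB m], rule AE_I2)
      (simp only: real_norm_def order_trans[OF le abs_ge_self])
  have "\<bar>fun_distribution h f\<bar> \<le> (LINT t|lborel. \<bar>h t * schwartz_fun f t\<bar>)"
    unfolding fun_distribution_def by (rule integral_abs_bound)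
  also have "\<dots> \<le> (LINT t|lborel. ?B t)"
    by (intro integral_mono integrable_abs int intB le)
  finally show "\<bar>fun_distribution h f\<bar> \<le>
      (C * (2 * 2 ^ (d + 2)) * (LINT t|lborel. inverse (1 + t\<^sup>2))) * seminorm_sum (d + 2) f"
    by (simp add: mult_ac)
qed

lemma integrable_mult_schwartz:
  assumes "continuous_on UNIV h" "poly_growth h"
  shows "integrable lborel (\<lambda>t. h t * schwartz_fun f t)"
  using assms(2) integrable_mult_schwartz_aux[OF borel_measurable_continuous_onI[OF assms(1)]]
  unfolding poly_growth_def by blast

lemma seminorm_bounded_fun_distribution:
  assumes cont: "continuous_on UNIV h" and growth: "poly_growth h"
  shows "seminorm_bounded (fun_distribution h)"
proof -
  note int = integrable_mult_schwartz[OF cont growth]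
  have "linear (fun_distribution h)"
    by (rule linearI)
      (simp_all add: fun_distribution_def plus_schwartz.rep_eq scaleR_schwartz.rep_eq distrib_left int
        mult.left_commute)
  moreover obtain C d where C: "C \<ge> 0" "\<And>t. \<bar>h t\<bar> \<le> C * (1 + \<bar>t\<bar>) ^ d"
    using growth unfolding poly_growth_def by blast
  have "0 \<le> C * (2 * 2 ^ (d + 2)) * (LINT t|lborel. inverse (1 + t\<^sup>2))"
    using C(1) by (intro mult_nonneg_nonneg integral_nonneg) auto
  ultimately show ?thesis
    unfolding seminorm_bounded_def
    using fun_distribution_bound[OF borel_measurable_continuous_onI[OF cont] C(2)] by blast
qed

lemma fun_distribution_lin_ext:
  assumes "\<And>a. continuous_on UNIV (H a)" "\<And>a. poly_growth (H a)"
  shows "fun_distribution (\<lambda>t. lin_ext (\<lambda>a. H a t) x) f = lin_ext (\<lambda>a. fun_distribution (H a) f) x"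
  using integrable_mult_schwartz[OF assms]
  by (simp add: fun_distribution_def lin_ext_def sum_distrib_right mult.assoc)

section \<open>Constants have zero distributional derivative\<close>

lemma schwartz_tendsto_0:
  "(schwartz_fun f \<longlongrightarrow> 0) at_top" "(schwartz_fun f \<longlongrightarrow> 0) at_bot"
proof -
  have b: "norm (schwartz_fun f t) \<le> norm (schwartz_seminorm 1 0 f / t)" if "t \<noteq> 0" for t
    using schwartz_seminorm_upper[of t 1 0 f] schwartz_seminorm_nonneg[of 1 0 f] that
    by (simp add: abs_mult pos_le_divide_eq mult.commute)
  have "((\<lambda>t::real. norm (schwartz_seminorm 1 0 f / t)) \<longlongrightarrow> 0) at_infinity"
    by (rule tendsto_norm_zero[OF tendsto_divide_0[OF tendsto_const filterlim_ident]])
  then have lim: "(schwartz_fun f \<longlongrightarrow> 0) at_infinity"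
    by (rule Lim_null_comparison[rotated])
      (use b in \<open>auto simp: eventually_at_infinity intro!: exI[of _ 1]\<close>)
  show "(schwartz_fun f \<longlongrightarrow> 0) at_top" "(schwartz_fun f \<longlongrightarrow> 0) at_bot"
    by (rule filterlim_mono[OF lim order_refl], simp add: at_top_le_at_infinity at_bot_le_at_infinity)+
qed

lemma integral_deriv_schwartz: "(LINT t|lborel. deriv (schwartz_fun f) t) = 0"
proof -
  have "integrable lborel (\<lambda>t. 1 * schwartz_fun (schwartz_deriv f) t)"
    by (rule integrable_mult_schwartz) (simp_all add: poly_growth_const)
  then have int: "integrable lborel (deriv (schwartz_fun f))"
    by (simp add: schwartz_fun_deriv)
  have "(LBINT t=-\<infinity>..\<infinity>. deriv (schwartz_fun f) t) = 0 - 0"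
  proof (rule interval_integral_FTC_integrable[where F = "schwartz_fun f"])
    show "(schwartz_fun f has_vector_derivative deriv (schwartz_fun f) x) (at x)" for x
      using schwartz_has_derivative by (simp add: has_real_derivative_iff_has_vector_derivative)
    show "isCont (deriv (schwartz_fun f)) x" for x
      using field_differentiable_imp_continuous_at[OF schwartz_differentiable[of 1 f x]] by simp
    show "set_integrable lborel (einterval (-\<infinity>) \<infinity>) (deriv (schwartz_fun f))"
      using int by (simp add: set_integrable_def)
    show "((schwartz_fun f \<circ> real_of_ereal) \<longlongrightarrow> 0) (at_right (-\<infinity>))"
      "((schwartz_fun f \<circ> real_of_ereal) \<longlongrightarrow> 0) (at_left \<infinity>)"
      using schwartz_tendsto_0 by (simp_all add: ereal_tendsto_simps)
  qed simp
  then show ?thesis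
    by (simp add: interval_lebesgue_integral_def set_lebesgue_integral_def)
qed

lemma distribution_deriv_const: "distribution_deriv (fun_distribution (\<lambda>_. c)) f = 0"
  by (simp add: distribution_deriv_def fun_distribution_def schwartz_fun_deriv integral_deriv_schwartz)

section \<open>Continuity into the strong dual\<close>

text \<open>The suprema over bounded sets of test functions define the strong dual topology.
  Homogeneity follows from the inequality for \<open>c\<close> combined with the one for
  \<open>1 / c\<close>.\<close>

lemma seminorm_pointwise_sup:
  fixes \<Phi> :: "'v::real_vector \<Rightarrow> 'f \<Rightarrow> real"
  assumes lin: "\<And>f. linear (\<lambda>v. \<Phi> v f)" and ne: "B \<noteq> {}"
    and bdd: "\<And>v. bdd_above ((\<lambda>f. \<bar>\<Phi> v f\<bar>) ` B)"
  shows "seminorm (\<lambda>v. SUP f\<in>B. \<bar>\<Phi> v f\<bar>)" (is "seminorm ?p")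
proof -
  have le: "\<bar>\<Phi> v f\<bar> \<le> ?p v" if "f \<in> B" for v f
    using that bdd by (intro cSUP_upper)
  have tri: "?p (x + y) \<le> ?p x + ?p y" for x y
  proof (rule cSUP_least[OF ne])
    fix f assume "f \<in> B"
    then show "\<bar>\<Phi> (x + y) f\<bar> \<le> ?p x + ?p y"
      using le[of f x] le[of f y] linear_add[OF lin[of f], of x y] by linarith
  qed
  have sub: "?p (c *\<^sub>R x) \<le> \<bar>c\<bar> * ?p x" for c x
    by (rule cSUP_least[OF ne]) (simp add: linear_cmul[OF lin] abs_mult mult_left_mono le)
  have "?p (c *\<^sub>R x) = \<bar>c\<bar> * ?p x" for c x
  proof (cases "c = 0")
    case True
    obtain f where "f \<in> B" using ne by blast
    then have "0 \<le> ?p (c *\<^sub>R x)" by (rule order_trans[OF abs_ge_zero le])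
    then show ?thesis using sub[of c x] True by simp
  next
    case False
    then have "?p x \<le> \<bar>1 / c\<bar> * ?p (c *\<^sub>R x)" using sub[of "1 / c" "c *\<^sub>R x"] by simp
    then have "\<bar>c\<bar> * ?p x \<le> ?p (c *\<^sub>R x)" using False by (simp add: field_simps)
    with sub[of c x] show ?thesis by (rule order_antisym)
  qed
  with tri show ?thesis by (simp add: seminorm_def)
qed

lemma seminorm_zero: "seminorm p \<Longrightarrow> p 0 = 0"
  unfolding seminorm_def by (metis abs_zero mult_zero_left scaleR_zero_left)

lemma seminorm_abs_diff: "seminorm p \<Longrightarrow> \<bar>p x - p y\<bar> \<le> p (x - y)"
proof -
  assume p: "seminorm p"
  have "p (y - x) = p (x - y)"
    using p[unfolded seminorm_def, THEN conjunct2, rule_format, of "-1" "x - y"] by simp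
  moreover have "p x \<le> p (x - y) + p y" "p y \<le> p (y - x) + p x"
    using p[unfolded seminorm_def, THEN conjunct1, rule_format, of "x - y" y]
      p[unfolded seminorm_def, THEN conjunct1, rule_format, of "y - x" x] by simp_all
  ultimately show ?thesis by linarith
qed

lemma abs_lin_ext_le:
  fixes F :: "'a \<Rightarrow> real"
  assumes "\<And>a. \<bar>F a\<bar> \<le> M a"
  shows "\<bar>lin_ext F x\<bar> \<le> (\<Sum>a\<in>Poly_Mapping.keys x. \<bar>Poly_Mapping.lookup x a\<bar> * M a)"
  unfolding lin_ext_def
  by (rule order_trans[OF sum_abs]) (auto simp: abs_mult intro!: sum_mono mult_left_mono assms)

lemma continuous_map_direct_sum_strong_dual:
  fixes P :: "'b \<Rightarrow> schwartz \<Rightarrow> real"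
  assumes P: "\<And>b. seminorm_bounded (P b)"
    and S: "\<And>a. a \<in> A \<Longrightarrow> finite (S a)"
    and T: "\<And>a x. a \<in> A \<Longrightarrow> x \<in> T a \<Longrightarrow> Poly_Mapping.keys x \<subseteq> S a"
  shows "continuous_map (direct_sum_topology A T) strong_dual_topology (\<lambda>v f. lin_ext (\<lambda>b. P b f) v)"
    (is "continuous_map ?D _ ?\<Pi>")
proof -
  have tempered: "?\<Pi> v \<in> tempered_distributions" for v
    by (intro seminorm_bounded_tempered seminorm_bounded_lin_ext P)
  have "UNIV \<in> {{y :: 'b \<Rightarrow>\<^sub>0 real. p (y - x) < e} | p x e.
      seminorm p \<and> (\<forall>a\<in>A. continuous_on (T a) p) \<and> e > 0}"
    by (rule CollectI, rule exI[of _ "\<lambda>_. 0"], rule exI[of _ 0], rule exI[of _ 1])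
      (simp add: seminorm_def)
  then have space: "topspace ?D = UNIV"
    unfolding direct_sum_topology_def topology_generated_by_topspace by blast
  show ?thesis
    unfolding strong_dual_topology_def
  proof (rule continuous_on_generated_topo)
    show "?\<Pi> ` topspace ?D \<subseteq> \<Union> {{S \<in> tempered_distributions. \<exists>d<e. \<forall>f\<in>B. \<bar>S f - T f\<bar> \<le> d} | T B e.
        T \<in> tempered_distributions \<and> schwartz_bounded B \<and> e > 0}"
    proof (clarify, rule UnionI)
      fix v
      \<comment> \<open>For the empty set of test functions the subbasic set consists of all
        tempered distributions.\<close>
      show "?\<Pi> v \<in> {S \<in> tempered_distributions. \<exists>d<1. \<forall>f\<in>{}. \<bar>S f - ?\<Pi> v f\<bar> \<le> d}"
        using tempered by (auto intro: exI[of _ 0])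
      have "schwartz_bounded {}" by (simp add: schwartz_bounded_def)
      then show "{S \<in> tempered_distributions. \<exists>d<1. \<forall>f\<in>{}. \<bar>S f - ?\<Pi> v f\<bar> \<le> d} \<in>
          {{S \<in> tempered_distributions. \<exists>d<e. \<forall>f\<in>B. \<bar>S f - T f\<bar> \<le> d} | T B e.
            T \<in> tempered_distributions \<and> schwartz_bounded B \<and> e > 0}"
        using tempered zero_less_one by blast
    qed
  next
    fix U
    assume "U \<in> {{S \<in> tempered_distributions. \<exists>d<e. \<forall>f\<in>B. \<bar>S f - T f\<bar> \<le> d} | T B e.
        T \<in> tempered_distributions \<and> schwartz_bounded B \<and> e > 0}"
    then obtain R B e where B: "schwartz_bounded B"
      and U: "U = {S \<in> tempered_distributions. \<exists>d<e. \<forall>f\<in>B. \<bar>S f - R f\<bar> \<le> d}"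
      by blast
    \<comment> \<open>Adding the zero function makes the supremum range over a nonempty set.\<close>
    define B0 where "B0 = insert 0 B"
    have B0: "schwartz_bounded B0" "B0 \<noteq> {}" using B by (auto simp: schwartz_bounded_def B0_def)
    have "\<exists>M. \<forall>f\<in>B0. \<bar>P b f\<bar> \<le> M" for b
      by (rule seminorm_bounded_on_bounded_set[OF P[of b] B0(1)]) blast
    then obtain M where M: "\<And>b f. f \<in> B0 \<Longrightarrow> \<bar>P b f\<bar> \<le> M b" by metis
    have M0: "M b \<ge> 0" for b using M[of 0 b] by (simp add: B0_def)
    define p where "p v = (SUP f\<in>B0. \<bar>?\<Pi> v f\<bar>)" for v
    have bound: "\<bar>?\<Pi> v f\<bar> \<le> (\<Sum>b\<in>Poly_Mapping.keys v. \<bar>Poly_Mapping.lookup v b\<bar> * M b)" if "f \<in> B0" for v f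
      by (rule abs_lin_ext_le) (rule M[OF that])
    have bdd: "bdd_above ((\<lambda>f. \<bar>?\<Pi> v f\<bar>) ` B0)" for v
      using bound by (rule bdd_aboveI2)
    have p: "seminorm p"
      unfolding p_def by (rule seminorm_pointwise_sup[OF linear_lin_ext B0(2) bdd])
    have p_upper: "\<bar>?\<Pi> v f\<bar> \<le> p v" if "f \<in> B0" for v f
      unfolding p_def by (rule cSUP_upper[OF that bdd])
    have cont: "continuous_on (T a) p" if a: "a \<in> A" for a
    proof (rule lipschitz_on_continuous_on[OF lipschitz_onI])
      show "0 \<le> (\<Sum>b\<in>S a. M b)" by (intro sum_nonneg M0)
      fix x y assume xy: "x \<in> T a" "y \<in> T a"
      have keys: "Poly_Mapping.keys (x - y) \<subseteq> S a"
        using T[OF a xy(1)] T[OF a xy(2)] keys_diff[of x y] by blast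
      have "p (x - y) \<le> (\<Sum>b\<in>Poly_Mapping.keys (x - y). \<bar>Poly_Mapping.lookup (x - y) b\<bar> * M b)"
        unfolding p_def by (rule cSUP_least[OF B0(2) bound])
      also have "\<dots> \<le> (\<Sum>b\<in>Poly_Mapping.keys (x - y). \<bar>Poly_Mapping.lookup (x - y) b\<bar> * (\<Sum>b\<in>S a. M b))"
        using keys by (intro sum_mono mult_left_mono member_le_sum S[OF a] M0) auto
      also have "\<dots> = (\<Sum>b\<in>S a. M b) * dist x y"
        by (simp add: dist_norm norm_poly_mapping_eq flip: sum_distrib_right)
      finally show "dist (p x) (p y) \<le> (\<Sum>b\<in>S a. M b) * dist x y"
        using seminorm_abs_diff[OF p, of x y] by (simp add: dist_real_def)
    qed
    show "openin ?D (?\<Pi> -` U \<inter> topspace ?D)"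
    proof (subst openin_subopen, intro ballI)
      fix v assume "v \<in> ?\<Pi> -` U \<inter> topspace ?D"
      then obtain d where d: "d < e" "\<And>f. f \<in> B \<Longrightarrow> \<bar>?\<Pi> v f - R f\<bar> \<le> d" using U by auto
      \<comment> \<open>The subbasic sets demand a uniform bound \<open>d\<close> strictly below
        \<open>e\<close>; the gap is the radius available around \<open>v\<close>.\<close>
      let ?W = "{w. p (w - v) < e - d}"
      have "?W \<in> {{y. p (y - x) < e} | p x e. seminorm p \<and> (\<forall>a\<in>A. continuous_on (T a) p) \<and> e > 0}"
        using p cont d(1) by (intro CollectI exI[of _ p] exI[of _ v] exI[of _ "e - d"]) auto
      then have "openin ?D ?W"
        unfolding direct_sum_topology_def by (rule topology_generated_by_Basis)
      moreover have "v \<in> ?W" using d(1) seminorm_zero[OF p] by simp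
      moreover have "?W \<subseteq> ?\<Pi> -` U \<inter> topspace ?D"
      proof
        fix w assume w: "w \<in> ?W"
        have "\<bar>?\<Pi> w f - R f\<bar> \<le> d + p (w - v)" if "f \<in> B" for f
          using p_upper[of f "w - v"] d(2)[OF that] that
            linear_diff[OF linear_lin_ext[of "\<lambda>b. P b f"], of w v]
          unfolding B0_def by simp
        moreover have "d + p (w - v) < e" using w by simp
        ultimately have "?\<Pi> w \<in> U" using tempered unfolding U by blast
        then show "w \<in> ?\<Pi> -` U \<inter> topspace ?D" using space by simp
      qed
      ultimately show "\<exists>W. openin ?D W \<and> v \<in> W \<and> W \<subseteq> ?\<Pi> -` U \<inter> topspace ?D" by blast
    qed
  qed
qed

section \<open>Finiteness of the homogeneous parts\<close>

lemma num_vertices_pos: "0 < num_vertices t"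
  by (cases t) simp

lemma finite_trees_num_vertices_le: "finite {t :: 'd::finite ptree. num_vertices t \<le> N}"
proof (induction N)
  case 0
  show ?case by (simp add: num_vertices_pos[THEN less_not_refl2])
next
  case (Suc N)
  have "{t :: 'd ptree. num_vertices t \<le> Suc N} \<subseteq>
      (\<lambda>(i, ts). Node i ts) ` (UNIV \<times> {ts. set ts \<subseteq> {t. num_vertices t \<le> N} \<and> length ts \<le> N})"
  proof
    fix t :: "'d ptree" assume t: "t \<in> {t. num_vertices t \<le> Suc N}"
    obtain i ts where node: "t = Node i ts" by (cases t)
    have sum: "sum_list (map num_vertices ts) \<le> N" using t node by simp
    have "num_vertices u \<le> N" if "u \<in> set ts" for u
      using member_le_sum_list[of "num_vertices u" "map num_vertices ts"] that sum by force
    moreover have "length ts \<le> sum_list (map num_vertices ts)"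
    proof (induction ts)
      case (Cons u us)
      then show ?case using num_vertices_pos[of u] by simp
    qed simp
    ultimately show "t \<in> (\<lambda>(i, ts). Node i ts) ` (UNIV \<times> {ts. set ts \<subseteq> {t. num_vertices t \<le> N} \<and> length ts \<le> N})"
      using node sum by (intro image_eqI[of _ _ "(i, ts)"]) auto
  qed
  then show ?case
    by (rule finite_subset) (intro finite_imageI finite_cartesian_product finite_lists_length_le Suc finite)
qed

text \<open>Charge every vertex with its incoming edge and its decorated leaf edge: this is 1 for
  decoration 0 and \<open>1 + (\<alpha> i - 1) = \<alpha> i\<close> otherwise, hence at least
  \<epsilon>. The root has no incoming edge, which the added 1 makes up for.\<close>

lemma etree_degree_phi_lower_bound:
  fixes \<alpha> :: "'d::zero \<Rightarrow> real"
  assumes "\<epsilon> \<le> 1" "\<And>i. i \<noteq> 0 \<Longrightarrow> \<epsilon> \<le> \<alpha> i"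
  shows "\<epsilon> * num_vertices t \<le> etree_degree \<alpha> (phi_etree t) + 1"
proof (induction t)
  case (Node i ts)
  have "\<epsilon> * sum_list (map num_vertices us) \<le> sum_list (map (\<lambda>u. 1 + etree_degree \<alpha> (phi_etree u)) us)"
    if "set us \<subseteq> set ts" for us
    using that
  proof (induction us)
    case (Cons u us)
    then show ?case using Node.IH[of u] by (simp add: distrib_left)
  qed simp
  from this[of ts] show ?case
    using assms(1) assms(2)[of i] by (cases "i = 0") (simp_all add: distrib_left comp_def)
qed

lemma finite_tree_degree:
  fixes \<alpha> :: "'d::{finite,zero} \<Rightarrow> real"
  assumes "\<And>i. i \<noteq> 0 \<Longrightarrow> 0 < \<alpha> i"
  shows "finite {\<tau>. tree_degree \<alpha> \<tau> = a}"
proof -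
  \<comment> \<open>The inserted 1 is the share of a vertex of decoration 0 and keeps the set
    nonempty if there is no other decoration.\<close>
  define \<epsilon> where "\<epsilon> = Min (insert 1 (\<alpha> ` (UNIV - {0})))"
  have \<epsilon>: "0 < \<epsilon>" "\<epsilon> \<le> 1" "\<And>i. i \<noteq> 0 \<Longrightarrow> \<epsilon> \<le> \<alpha> i"
    unfolding \<epsilon>_def using assms by (auto intro: Min_le)
  have "{\<tau>. tree_degree \<alpha> \<tau> = a} \<subseteq> phi ` {t. num_vertices t \<le> nat \<lceil>(a + 1) / \<epsilon>\<rceil>}"
  proof
    fix \<tau> assume \<tau>: "\<tau> \<in> {\<tau>. tree_degree \<alpha> \<tau> = a}"
    obtain t where t: "\<tau> = phi t" using bij_is_surj[OF bij_phi] by (metis surj_def)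
    have "real (num_vertices t) \<le> (a + 1) / \<epsilon>"
      using etree_degree_phi_lower_bound[where \<alpha> = \<alpha> and t = t, OF \<epsilon>(2,3)] \<tau> t \<epsilon>(1)
      by (simp add: tree_degree_def Rep_phi pos_le_divide_eq mult.commute)
    then have "num_vertices t \<le> nat \<lceil>(a + 1) / \<epsilon>\<rceil>" by linarith
    with t show "\<tau> \<in> phi ` {t. num_vertices t \<le> nat \<lceil>(a + 1) / \<epsilon>\<rceil>}" by blast
  qed
  then show ?thesis
    by (rule finite_subset) (intro finite_imageI finite_trees_num_vertices_le)
qed

section \<open>Grading of the pruned parts\<close>

definition graded :: "nat \<Rightarrow> ('d forest \<Rightarrow>\<^sub>0 real) \<Rightarrow> bool" where
  "graded n x \<longleftrightarrow> (\<forall>a\<in>Poly_Mapping.keys x. forest_size a = n)"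

lemma graded_add: "graded n x \<Longrightarrow> graded n y \<Longrightarrow> graded n (x + y)"
  using keys_add[of x y] by (auto simp: graded_def)

lemma graded_lin_ext:
  assumes "\<And>a. a \<in> Poly_Mapping.keys x \<Longrightarrow> graded n (F a)"
  shows "graded n (lin_ext F x)"
proof -
  have "graded n (\<Sum>a\<in>S. c a *\<^sub>R F a)" if "finite S" "S \<subseteq> Poly_Mapping.keys x" for S c
    using that
  proof (induction S)
    case (insert a S)
    have "graded n (c a *\<^sub>R F a)"
      using assms[of a] insert.prems by (auto simp: graded_def in_keys_iff)
    then show ?case using insert by (simp add: graded_add)
  qed (simp add: graded_def)
  then show ?thesis by (simp add: lin_ext_def)
qed

lemma graded_lmap_Cons: "graded n x \<Longrightarrow> graded (num_vertices t + n) (lmap ((#) t) x)"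
  unfolding lmap_def by (rule graded_lin_ext) (simp add: graded_def forest_size_def)

lemma graded_shuffle_words: "graded (forest_size xs + forest_size ys) (shuffle_words xs ys)"
proof (induction xs ys rule: shuffle_words.induct)
  case (3 x xs y ys)
  have "graded (num_vertices x + (forest_size xs + forest_size (y # ys)))
      (lmap ((#) x) (shuffle_words xs (y # ys)))"
    by (rule graded_lmap_Cons) (rule 3)
  moreover have "graded (num_vertices y + (forest_size (x # xs) + forest_size ys))
      (lmap ((#) y) (shuffle_words (x # xs) ys))"
    by (rule graded_lmap_Cons) (rule 3)
  ultimately show ?case
    by (simp add: graded_add forest_size_def ac_simps)
qed (simp_all add: graded_def forest_size_def)

lemma graded_shuffle:
  assumes "graded m x" "graded n y"
  shows "graded (m + n) (shuffle x y)"
  unfolding shuffle_def bilin_ext_def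
  by (intro graded_lin_ext) (metis assms graded_def graded_shuffle_words)

lemma graded_foldr_shuffle:
  assumes "\<And>j. j \<in> set js \<Longrightarrow> graded (N j) (F j)"
  shows "graded (sum_list (map N js)) (foldr shuffle (map F js) (basis []))"
  using assms by (induction js) (simp_all add: graded_shuffle graded_def[of 0] forest_size_def)

lemma sum_list_filter_partition:
  fixes f :: "'a \<Rightarrow> nat"
  shows "sum_list (map f xs) =
    sum_list (map f (filter P xs)) + sum_list (map f (filter (\<lambda>x. \<not> P x) xs))"
  by (induction xs) auto

text \<open>The pruned part and the trunk share out the vertices of \<open>t\<close>. The inequality
  is proved along with the grading because it makes the subtraction of natural numbers
  exact.\<close>

lemma graded_pruned: "graded (num_vertices t - num_vertices (trunk c t)) (pruned c t) \<and>
  num_vertices (trunk c t) \<le> num_vertices t"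
proof (induction t arbitrary: c)
  case (Node i ts)
  let ?I = "filter (\<lambda>j. [j] \<in> c) [0..<length ts]" and ?O = "filter (\<lambda>j. [j] \<notin> c) [0..<length ts]"
  let ?v = "\<lambda>j. num_vertices (ts ! j)"
  let ?w = "\<lambda>j. num_vertices (trunk (cut_below j c) (ts ! j))"
  have le: "?w j \<le> ?v j" and gr: "graded (?v j - ?w j) (pruned (cut_below j c) (ts ! j))"
    if "j \<in> set ?O" for j
  proof -
    have "ts ! j \<in> set ts" using that by simp
    from Node.IH[OF this, of "cut_below j c"] show "?w j \<le> ?v j"
      and "graded (?v j - ?w j) (pruned (cut_below j c) (ts ! j))" by blast+
  qed
  have "sum_list (map num_vertices ts) = sum_list (map ?v [0..<length ts])"
    by (simp add: sum_list_sum_nth atLeast0LessThan)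
  also have "\<dots> = sum_list (map ?v ?I) + sum_list (map ?v ?O)"
    by (rule sum_list_filter_partition)
  finally have total: "sum_list (map num_vertices ts) = sum_list (map ?v ?I) + sum_list (map ?v ?O)" .
  have "sum_list (map ?w js) \<le> sum_list (map ?v js) \<and>
      sum_list (map (\<lambda>j. ?v j - ?w j) js) = sum_list (map ?v js) - sum_list (map ?w js)"
    if "set js \<subseteq> set ?O" for js
    using that
  proof (induction js)
    case (Cons j js)
    then show ?case using le[of j] by simp
  qed simp
  from this[of ?O] have out: "sum_list (map ?w ?O) \<le> sum_list (map ?v ?O)"
    "sum_list (map (\<lambda>j. ?v j - ?w j) ?O) = sum_list (map ?v ?O) - sum_list (map ?w ?O)" by auto
  have below: "graded (sum_list (map (\<lambda>j. ?v j - ?w j) ?O))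
      (foldr shuffle (map (\<lambda>j. pruned (cut_below j c) (ts ! j)) ?O) (basis []))"
    by (rule graded_foldr_shuffle) (rule gr)
  have "graded (sum_list (map ?v ?I)) (basis (map ((!) ts) ?I))"
    by (simp add: graded_def forest_size_def comp_def)
  from graded_shuffle[OF this below]
  have "graded (sum_list (map ?v ?I) + sum_list (map (\<lambda>j. ?v j - ?w j) ?O)) (pruned c (Node i ts))"
    by simp
  moreover have "num_vertices (trunk c (Node i ts)) = Suc (sum_list (map ?w ?O))"
    by (simp add: comp_def)
  ultimately show ?case
    using total out by (simp del: trunk.simps pruned.simps)
qed

text \<open>A nonempty forest in the trunk retains at least one vertex besides the added root. The
  induction for polynomial growth decreases for this reason.\<close>

lemma pruned_size_less:
  assumes "branches (trunk c (Node i \<omega>)) \<noteq> []" "a \<in> Poly_Mapping.keys (pruned c (Node i \<omega>))"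
  shows "forest_size a < forest_size \<omega>"
proof -
  obtain j us where us: "trunk c (Node i \<omega>) = Node j us" by (cases "trunk c (Node i \<omega>)")
  have "us \<noteq> []" using assms(1)[unfolded us] by simp
  then have "0 < sum_list (map num_vertices us)"
    using num_vertices_pos by (cases us) auto
  then show ?thesis
    using graded_pruned[of "Node i \<omega>" c] assms(2) us
    by (auto simp: graded_def forest_size_def simp del: trunk.simps pruned.simps)
qed

text \<open>Cutting all root edges is the only way to leave an empty trunk. In Chen's relation this
  term reproduces the old value on \<open>\<omega>\<close>, and the others involve strictly smaller
  pruned forests.\<close>

lemma act_forest_split:
  assumes f: "forest_character f"
  shows "act_forest f \<omega> = f (basis \<omega>) *\<^sub>R basis [] +
    (\<Sum>c | c \<in> cuts (Node 0 \<omega>) \<and> branches (trunk c (Node 0 \<omega>)) \<noteq> [].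
      f (pruned c (Node 0 \<omega>)) *\<^sub>R basis (branches (trunk c (Node 0 \<omega>))))"
proof -
  let ?F = "\<lambda>c. f (pruned c (Node 0 \<omega>)) *\<^sub>R basis (branches (trunk c (Node 0 \<omega>)))"
  let ?J = "{c. c \<in> cuts (Node 0 \<omega>) \<and> branches (trunk c (Node 0 \<omega>)) \<noteq> []}"
  let ?c = "node_cut (length \<omega>) []"
  have trunk: "branches (trunk ?c (Node 0 \<omega>)) = []"
    using trunk_node_cut[of "length \<omega>" \<omega> "[]" 0] by (simp del: trunk.simps)
  have full: "?c \<in> cuts (Node 0 \<omega>)"
    using left_admissible_node_cut[of "length \<omega>" \<omega> "[]" 0] by (simp add: cuts_def)
  have "cuts (Node 0 \<omega>) = insert ?c ?J"
  proof (intro equalityI subsetI)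
    fix c assume c: "c \<in> cuts (Node 0 \<omega>)"
    then have "c \<in> (\<lambda>(k, cs). node_cut k cs) ` (SIGMA k:{..length \<omega>}. listset (map cuts (drop k \<omega>)))"
      using bij_betw_imp_surj_on[OF bij_betw_node_cut[of \<omega> 0]] by blast
    then obtain k cs where kcs: "k \<le> length \<omega>" "cs \<in> listset (map cuts (drop k \<omega>))" "c = node_cut k cs"
      by auto
    show "c \<in> insert ?c ?J"
    proof (cases "k = length \<omega>")
      case True
      then show ?thesis using kcs by auto
    next
      case False
      then have "branches (trunk c (Node 0 \<omega>)) \<noteq> []"
        using kcs(1) listset_cuts_D(1)[OF kcs(2)]
        by (auto simp add: kcs(3) trunk_node_cut[OF kcs(1) listset_cuts_D[OF kcs(2)]] simp del: trunk.simps)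
      with c show ?thesis by blast
    qed
  qed (use full in auto)
  then have "act_forest f \<omega> = sum ?F (insert ?c ?J)" by (simp only: act_forest_def)
  also have "\<dots> = ?F ?c + sum ?F ?J"
    by (rule sum.insert) (use trunk finite_cuts[of "Node 0 \<omega>"] in \<open>simp_all del: trunk.simps\<close>)
  also have "?F ?c = f (basis \<omega>) *\<^sub>R basis []"
    using trunk pruned_node_cut[of "length \<omega>" \<omega> "[]" 0]
    by (simp add: forest_characterD[OF f] del: pruned.simps trunk.simps)
  finally show ?thesis .
qed

section \<open>Functions of polynomial growth\<close>

lemma poly_growth_add:
  assumes "poly_growth f" "poly_growth g"
  shows "poly_growth (\<lambda>t. f t + g t)"
proof -
  obtain C d where f: "C \<ge> 0" "\<And>t. \<bar>f t\<bar> \<le> C * (1 + \<bar>t\<bar>) ^ d"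
    using assms(1) unfolding poly_growth_def by blast
  obtain D e where g: "D \<ge> 0" "\<And>t. \<bar>g t\<bar> \<le> D * (1 + \<bar>t\<bar>) ^ e"
    using assms(2) unfolding poly_growth_def by blast
  have "\<bar>f t + g t\<bar> \<le> (C + D) * (1 + \<bar>t\<bar>) ^ max d e" for t
  proof -
    have "\<bar>f t + g t\<bar> \<le> C * (1 + \<bar>t\<bar>) ^ d + D * (1 + \<bar>t\<bar>) ^ e"
      using f(2)[of t] g(2)[of t] by linarith
    also have "\<dots> \<le> C * (1 + \<bar>t\<bar>) ^ max d e + D * (1 + \<bar>t\<bar>) ^ max d e"
      using f(1) g(1) by (intro add_mono mult_left_mono power_increasing) auto
    finally show ?thesis by (simp add: distrib_right)
  qed
  then show ?thesis
    unfolding poly_growth_def using f(1) g(1) by (intro exI[of _ "C + D"] exI[of _ "max d e"]) auto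
qed

lemma poly_growth_cmult:
  assumes "poly_growth f"
  shows "poly_growth (\<lambda>t. c * f t)"
proof -
  obtain C d where f: "C \<ge> 0" "\<And>t. \<bar>f t\<bar> \<le> C * (1 + \<bar>t\<bar>) ^ d"
    using assms unfolding poly_growth_def by blast
  have "\<bar>c * f t\<bar> \<le> (\<bar>c\<bar> * C) * (1 + \<bar>t\<bar>) ^ d" for t
    using mult_left_mono[OF f(2)[of t], of "\<bar>c\<bar>"] by (simp add: abs_mult mult.assoc)
  then show ?thesis
    unfolding poly_growth_def using f(1) by (intro exI[of _ "\<bar>c\<bar> * C"] exI[of _ d]) auto
qed

lemma poly_growth_abs: "poly_growth f \<Longrightarrow> poly_growth (\<lambda>t. \<bar>f t\<bar>)"
  by (simp add: poly_growth_def)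

lemma poly_growth_sum:
  assumes "\<And>a. a \<in> S \<Longrightarrow> poly_growth (F a)"
  shows "poly_growth (\<lambda>t. \<Sum>a\<in>S. F a t)"
  using assms
  by (induction S rule: infinite_finite_induct) (simp_all add: poly_growth_const poly_growth_add)

text \<open>
  Iterating the increment inequality along steps of length at most \<open>h\<close> costs a factor linear
  in \<open>\<bar>t\<bar>\<close>.
\<close>

lemma poly_growth_of_increments:
  assumes h: "0 < h" and G: "poly_growth G"
    and step: "\<And>u v. \<bar>v - u\<bar> \<le> h \<Longrightarrow> \<bar>F v\<bar> \<le> \<bar>F u\<bar> + G u"
  shows "poly_growth F"
proof -
  obtain C d where C: "C \<ge> 0" "\<And>t. \<bar>G t\<bar> \<le> C * (1 + \<bar>t\<bar>) ^ d"
    using G unfolding poly_growth_def by blast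
  have "\<bar>F t\<bar> \<le> (\<bar>F 0\<bar> + (1 / h + 1) * C) * (1 + \<bar>t\<bar>) ^ (d + 1)" for t
  proof -
    let ?M = "C * (1 + \<bar>t\<bar>) ^ d"
    have M: "G u \<le> ?M" if "\<bar>u\<bar> \<le> \<bar>t\<bar>" for u
    proof -
      have "G u \<le> C * (1 + \<bar>u\<bar>) ^ d" using C(2)[of u] by linarith
      also have "\<dots> \<le> ?M" using that C(1) by (intro mult_left_mono power_mono) auto
      finally show ?thesis .
    qed
    have iter: "\<bar>F u\<bar> \<le> \<bar>F 0\<bar> + real n * ?M" if "\<bar>u\<bar> \<le> real n * h" "\<bar>u\<bar> \<le> \<bar>t\<bar>" for n u
      using that
    proof (induction n arbitrary: u)
      case (Suc n)
      \<comment> \<open>The point at the fraction \<open>n / (n + 1)\<close> of the way from 0 to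
        \<open>u\<close>: one step away from \<open>u\<close>, reachable in \<open>n\<close> steps,
        and no farther from 0 than \<open>\<bar>t\<bar>\<close>.\<close>
      let ?v = "u * (real n / real (Suc n))"
      have v: "\<bar>?v\<bar> = \<bar>u\<bar> * (real n / real (Suc n))" by (simp add: abs_mult)
      have "\<bar>u\<bar> * (real n / real (Suc n)) \<le> real (Suc n) * h * (real n / real (Suc n))"
        by (rule mult_right_mono) (use Suc.prems in auto)
      then have v1: "\<bar>?v\<bar> \<le> real n * h" unfolding v by (simp add: mult.commute)
      have v2: "\<bar>?v\<bar> \<le> \<bar>t\<bar>"
        unfolding v using Suc.prems(2) by (intro order_trans[OF mult_left_le]) auto
      have "u - ?v = u * (1 / real (Suc n))" by (simp add: field_simps)
      then have "\<bar>u - ?v\<bar> = \<bar>u\<bar> * (1 / real (Suc n))" by (simp add: abs_mult)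
      also have "\<dots> \<le> real (Suc n) * h * (1 / real (Suc n))"
        by (rule mult_right_mono) (use Suc.prems in auto)
      also have "\<dots> = h" by simp
      finally have "\<bar>F u\<bar> \<le> \<bar>F ?v\<bar> + G ?v" by (rule step)
      also have "\<dots> \<le> (\<bar>F 0\<bar> + real n * ?M) + ?M"
        by (intro add_mono Suc.IH[OF v1 v2] M[OF v2])
      finally show ?case by (simp add: algebra_simps)
    qed simp
    \<comment> \<open>The number of steps needed to reach \<open>t\<close>. Being at most
      \<open>\<bar>t\<bar> / h + 1\<close>, it accounts for the constant \<open>1 / h + 1\<close>
      and for one more power of \<open>1 + \<bar>t\<bar>\<close>.\<close>
    define n where "n = nat \<lceil>\<bar>t\<bar> / h\<rceil>"
    have n: "\<bar>t\<bar> / h \<le> real n" "real n \<le> \<bar>t\<bar> / h + 1"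
      unfolding n_def using h by (auto simp: real_nat_ceiling_ge)
    have "\<bar>t\<bar> \<le> real n * h" using n(1) h by (simp add: field_simps)
    then have "\<bar>F t\<bar> \<le> \<bar>F 0\<bar> + real n * ?M" by (rule iter) simp
    also have "real n * ?M \<le> ((1 / h + 1) * (1 + \<bar>t\<bar>)) * ?M"
    proof (rule mult_right_mono)
      have "\<bar>t\<bar> / h + 1 \<le> (1 / h + 1) * (1 + \<bar>t\<bar>)" using h by (simp add: field_simps)
      with n(2) show "real n \<le> (1 / h + 1) * (1 + \<bar>t\<bar>)" by linarith
    qed (use C(1) in auto)
    also have "\<bar>F 0\<bar> \<le> \<bar>F 0\<bar> * (1 + \<bar>t\<bar>) ^ (d + 1)"
      using one_le_power[of "1 + \<bar>t\<bar>" "d + 1"] by (simp add: mult_le_cancel_left1 del: power_Suc)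
    finally show ?thesis by (simp add: algebra_simps)
  qed
  then show ?thesis
    unfolding poly_growth_def using C(1) h
    by (intro exI[of _ "\<bar>F 0\<bar> + (1 / h + 1) * C"] exI[of _ "d + 1"]) auto
qed

section \<open>Planarly branched rough paths\<close>

lemma linear_lmap_eq: "linear g \<Longrightarrow> g (lmap h x) = lin_ext (\<lambda>a. g (basis (h a))) x"
  by (simp add: lmap_def linear_lin_ext_comp)

lemma forest_size_pos: "\<omega> \<noteq> [] \<Longrightarrow> 0 < forest_size (\<omega> :: 'd forest)"
  using num_vertices_pos by (cases \<omega>) (auto simp: forest_size_def)

lemma gamma_character_eq: "gamma_character \<XX> s t = (\<lambda>x. \<XX> s t (lmap Bplus_phi_inv x))"
  by (simp add: gamma_character_def fun_eq_iff)

lemma linear_model_Gamma: "linear (model_Gamma \<XX> s t)"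
  unfolding model_Gamma_def by (rule linear_Gamma_of)

lemma linear_eq_on_phi:
  assumes "linear F" "linear G" "\<And>\<tau>. F (basis (phi \<tau>)) = G (basis (phi \<tau>))"
  shows "F x = G x"
  by (rule linear_eq_on_basis[OF assms(1,2)]) (metis assms(3) bij_is_surj bij_phi surj_def)

lemma model_Pi_tree_phi:
  "model_Pi_tree \<XX> s (phi (Node i \<omega>)) =
    (if i = 0 then fun_distribution (\<lambda>t. \<XX> s t (basis \<omega>))
     else distribution_deriv (fun_distribution (\<lambda>t. \<XX> s t (basis [Node i \<omega>]))))"
  unfolding model_Pi_tree_def root_undecorated_phi Bplus_phi_simps
  by (simp add: phi_Node_0 incl_inverse)

lemma model_Pi_eq: "model_Pi \<XX> s = (\<lambda>v f. lin_ext (\<lambda>\<tau>. model_Pi_tree \<XX> s \<tau> f) v)"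
  by (simp add: model_Pi_def fun_eq_iff)

lemma linear_model_Pi: "linear (\<lambda>v. model_Pi \<XX> s v f)"
  unfolding model_Pi_eq by (rule linear_lin_ext)

context
  fixes h :: ereal and \<gamma> :: real
    and X :: "'d::{finite,zero} \<Rightarrow> real \<Rightarrow> real"
    and \<XX> :: "real \<Rightarrow> real \<Rightarrow> ('d forest \<Rightarrow>\<^sub>0 real) \<Rightarrow> real"
  assumes rough: "planarly_branched_rough_path h \<gamma> X \<XX>"
begin

lemma character_rough: "forest_character (\<XX> s t)"
  using rough by (simp add: planarly_branched_rough_path_def forest_character_def)

lemmas linear_rough = forest_characterD(1)[OF character_rough]

lemma chen: "\<XX> s t (basis \<omega>) = \<XX> u t (act_forest (\<XX> s u) \<omega>)"
  using rough convolution_basis[OF linear_rough[of s u] linear_rough[of u t], of \<omega>]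
  by (simp add: planarly_branched_rough_path_def)

lemma rough_diag: "\<omega> \<noteq> [] \<Longrightarrow> \<XX> s s (basis \<omega>) = 0"
  by (rule idempotent_character[OF character_rough chen])

section \<open>Continuity and growth in the second time variable\<close>

lemma rough_local_bound:
  obtains \<delta> where "0 < \<delta>" "\<delta> \<le> 1"
    "\<And>\<omega>. \<exists>C\<ge>0. \<forall>s t. s \<noteq> t \<longrightarrow> \<bar>t - s\<bar> \<le> \<delta> \<longrightarrow>
      \<bar>\<XX> s t (basis \<omega>)\<bar> \<le> C * \<bar>t - s\<bar> powr (\<gamma> * forest_size \<omega>)"
proof -
  \<comment> \<open>A finite radius, also for infinite \<open>h\<close>, and the same for all
    forests. Being at most 1, it later bounds the powers of \<open>\<bar>t - s\<bar>\<close> by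
    1.\<close>
  obtain \<delta> where \<delta>: "0 < \<delta>" "\<delta> \<le> 1" "ereal \<delta> \<le> h"
  proof (cases h)
    case (real r)
    then show ?thesis
      using rough that[of "min r 1"] by (auto simp: planarly_branched_rough_path_def)
  next
    case PInf
    then show ?thesis using that[of 1] by simp
  next
    case MInf
    then show ?thesis using rough by (simp add: planarly_branched_rough_path_def)
  qed
  have "\<exists>C\<ge>0. \<forall>s t. s \<noteq> t \<longrightarrow> \<bar>t - s\<bar> \<le> \<delta> \<longrightarrow>
      \<bar>\<XX> s t (basis \<omega>)\<bar> \<le> C * \<bar>t - s\<bar> powr (\<gamma> * forest_size \<omega>)" for \<omega>
  proof -
    have "bdd_above {\<bar>\<XX> s t (basis \<omega>)\<bar> / \<bar>t - s\<bar> powr (\<gamma> * forest_size \<omega>) | s t.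
        s \<noteq> t \<and> ereal \<bar>t - s\<bar> \<le> h}"
      using rough by (simp add: planarly_branched_rough_path_def)
    then obtain C where C: "\<And>s t. s \<noteq> t \<Longrightarrow> ereal \<bar>t - s\<bar> \<le> h \<Longrightarrow>
        \<bar>\<XX> s t (basis \<omega>)\<bar> / \<bar>t - s\<bar> powr (\<gamma> * forest_size \<omega>) \<le> C"
      unfolding bdd_above_def by blast
    have "\<bar>\<XX> s t (basis \<omega>)\<bar> \<le> max C 0 * \<bar>t - s\<bar> powr (\<gamma> * forest_size \<omega>)"
      if "s \<noteq> t" "\<bar>t - s\<bar> \<le> \<delta>" for s t
    proof -
      have "ereal \<bar>t - s\<bar> \<le> h"
        using that(2) \<delta>(3) by (meson ereal_less_eq(3) order_trans)
      then have "\<bar>\<XX> s t (basis \<omega>)\<bar> / \<bar>t - s\<bar> powr (\<gamma> * forest_size \<omega>) \<le> max C 0"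
        using C[OF that(1)] by (simp add: le_max_iff_disj)
      moreover have "\<bar>t - s\<bar> powr (\<gamma> * forest_size \<omega>) > 0" using that(1) by simp
      ultimately show ?thesis by (simp add: pos_divide_le_eq)
    qed
    then show ?thesis by (intro exI[of _ "max C 0"]) auto
  qed
  with \<delta>(1,2) show thesis by (rule that)
qed

lemma rough_gamma_pos: "0 < \<gamma>"
  using rough by (simp add: planarly_branched_rough_path_def)

lemma rough_tendsto_diag: "((\<lambda>t. \<XX> u t (basis \<omega>)) \<longlongrightarrow> \<XX> u u (basis \<omega>)) (at u)"
proof (cases "\<omega> = []")
  case True
  then show ?thesis by (simp add: forest_characterD[OF character_rough])
next
  case False
  obtain \<delta> where \<delta>: "0 < \<delta>" and "\<And>\<omega>. \<exists>C\<ge>0. \<forall>s t. s \<noteq> t \<longrightarrow> \<bar>t - s\<bar> \<le> \<delta> \<longrightarrow>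
      \<bar>\<XX> s t (basis \<omega>)\<bar> \<le> C * \<bar>t - s\<bar> powr (\<gamma> * forest_size \<omega>)"
    using rough_local_bound by metis
  then obtain C where C: "\<And>s t. s \<noteq> t \<Longrightarrow> \<bar>t - s\<bar> \<le> \<delta> \<Longrightarrow>
      \<bar>\<XX> s t (basis \<omega>)\<bar> \<le> C * \<bar>t - s\<bar> powr (\<gamma> * forest_size \<omega>)"
    by blast
  have pos: "0 < \<gamma> * forest_size \<omega>"
    using rough_gamma_pos forest_size_pos[OF False] by simp
  have "((\<lambda>t. \<bar>t - u\<bar> powr (\<gamma> * forest_size \<omega>)) \<longlongrightarrow> 0) (at u)"
    by (rule tendsto_zero_powrI[where b = "\<gamma> * forest_size \<omega>"])
      (auto intro!: tendsto_eq_intros pos)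
  then have "((\<lambda>t. C * \<bar>t - u\<bar> powr (\<gamma> * forest_size \<omega>)) \<longlongrightarrow> 0) (at u)"
    by (rule tendsto_mult_right_zero)
  then have "((\<lambda>t. \<XX> u t (basis \<omega>)) \<longlongrightarrow> 0) (at u)"
  proof (rule Lim_null_comparison[rotated])
    show "eventually (\<lambda>t. norm (\<XX> u t (basis \<omega>)) \<le> C * \<bar>t - u\<bar> powr (\<gamma> * forest_size \<omega>)) (at u)"
      unfolding eventually_at using \<delta> C
      by (intro exI[of _ \<delta>]) (auto simp: dist_real_def)
  qed
  then show ?thesis by (simp add: rough_diag[OF False])
qed

text \<open>Chen's relation with intermediate time \<open>u\<close> leaves \<open>t\<close> only in
  \<open>\<XX> u t\<close>, applied to a fixed vector. Continuity at \<open>u\<close> is thereby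
  reduced to the diagonal, where the Hoelder bound gives it.\<close>

lemma isCont_rough: "isCont (\<lambda>t. \<XX> s t (basis \<omega>)) u"
proof -
  have "((\<lambda>t. \<XX> u t x) \<longlongrightarrow> \<XX> u u x) (at u)" for x
    unfolding linear_eq_lin_ext[OF linear_rough, of _ _ x] lin_ext_def
    by (intro tendsto_sum tendsto_scaleR tendsto_const rough_tendsto_diag)
  from this[of "act_forest (\<XX> s u) \<omega>"] show ?thesis
    by (simp add: isCont_def flip: chen)
qed

lemma continuous_on_rough: "continuous_on UNIV (\<lambda>t. \<XX> s t (basis \<omega>))"
  by (simp add: continuous_at_imp_continuous_on isCont_rough)

text \<open>In Chen's relation from \<open>s\<close> over \<open>u\<close> to a nearby
  \<open>t\<close>, the trunks are evaluated by \<open>\<XX> u t\<close>, which is bounded uniformly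
  in \<open>u\<close>, and the pruned parts by \<open>\<XX> s u\<close>, which grows polynomially by
  the induction hypothesis. The increment over a short step is thus bounded by a function of
  \<open>u\<close> of polynomial growth.\<close>

lemma poly_growth_rough: "poly_growth (\<lambda>t. \<XX> s t (basis \<omega>))"
proof (induction "forest_size \<omega>" arbitrary: \<omega> rule: less_induct)
  case less
  obtain \<delta> where \<delta>: "0 < \<delta>" "\<delta> \<le> 1" and local: "\<And>\<omega>. \<exists>C\<ge>0. \<forall>s t. s \<noteq> t \<longrightarrow> \<bar>t - s\<bar> \<le> \<delta> \<longrightarrow>
      \<bar>\<XX> s t (basis \<omega>)\<bar> \<le> C * \<bar>t - s\<bar> powr (\<gamma> * forest_size \<omega>)"
    using rough_local_bound by metis
  have "\<exists>K. \<forall>u t. \<bar>t - u\<bar> \<le> \<delta> \<longrightarrow> \<bar>\<XX> u t (basis \<sigma>)\<bar> \<le> K" for \<sigma>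
  proof -
    obtain C where C: "C \<ge> 0" "\<And>s t. s \<noteq> t \<Longrightarrow> \<bar>t - s\<bar> \<le> \<delta> \<Longrightarrow>
        \<bar>\<XX> s t (basis \<sigma>)\<bar> \<le> C * \<bar>t - s\<bar> powr (\<gamma> * forest_size \<sigma>)"
      using local by blast
    \<comment> \<open>The 1 covers the empty forest on the diagonal, which the local estimate leaves
      out.\<close>
    have "\<bar>\<XX> u t (basis \<sigma>)\<bar> \<le> max C 1" if tu: "\<bar>t - u\<bar> \<le> \<delta>" for u t
    proof (cases "u = t")
      case True
      then show ?thesis
        by (cases "\<sigma> = []") (simp_all add: forest_characterD[OF character_rough] rough_diag le_max_iff_disj)
    next
      case False
      have "\<bar>t - u\<bar> powr (\<gamma> * forest_size \<sigma>) \<le> 1"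
        using tu \<delta> rough_gamma_pos by (intro powr_le1) auto
      then have "\<bar>\<XX> u t (basis \<sigma>)\<bar> \<le> C"
        using C(2)[OF False tu] mult_left_le[OF _ C(1)] by fastforce
      then show ?thesis by simp
    qed
    then show ?thesis by blast
  qed
  then obtain K where K: "\<And>\<sigma> u t. \<bar>t - u\<bar> \<le> \<delta> \<Longrightarrow> \<bar>\<XX> u t (basis \<sigma>)\<bar> \<le> K \<sigma>" by metis
  let ?J = "{c. c \<in> cuts (Node 0 \<omega>) \<and> branches (trunk c (Node 0 \<omega>)) \<noteq> []}"
  let ?P = "\<lambda>c. pruned c (Node 0 \<omega>)" and ?T = "\<lambda>c. branches (trunk c (Node 0 \<omega>))"
  define G where "G u = (\<Sum>c\<in>?J. K (?T c) * \<bar>\<XX> s u (?P c)\<bar>)" for u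
  have "poly_growth (\<lambda>u. \<XX> s u (?P c))" if "c \<in> ?J" for c
    unfolding linear_eq_lin_ext[OF linear_rough, of _ _ "?P c"] lin_ext_def real_scaleR_def
    by (intro poly_growth_sum poly_growth_cmult less pruned_size_less) (use that in auto)
  then have "poly_growth G"
    unfolding G_def by (intro poly_growth_sum poly_growth_cmult poly_growth_abs)
  moreover have "\<bar>\<XX> s t (basis \<omega>)\<bar> \<le> \<bar>\<XX> s u (basis \<omega>)\<bar> + G u" if "\<bar>t - u\<bar> \<le> \<delta>" for u t
  proof -
    have "\<XX> s t (basis \<omega>) =
        \<XX> s u (basis \<omega>) + (\<Sum>c\<in>?J. \<XX> s u (?P c) * \<XX> u t (basis (?T c)))"
      by (simp add: chen[of s t \<omega> u] act_forest_split[OF character_rough] linear_add[OF linear_rough]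
          linear_cmul[OF linear_rough] linear_sum[OF linear_rough] forest_characterD(2)[OF character_rough]
          del: pruned.simps trunk.simps)
    moreover have "\<bar>\<Sum>c\<in>?J. \<XX> s u (?P c) * \<XX> u t (basis (?T c))\<bar> \<le> G u"
      unfolding G_def
    proof (rule order_trans[OF sum_abs], rule sum_mono)
      fix c
      show "\<bar>\<XX> s u (?P c) * \<XX> u t (basis (?T c))\<bar> \<le> K (?T c) * \<bar>\<XX> s u (?P c)\<bar>"
        using mult_right_mono[OF K[OF that, of "?T c"], of "\<bar>\<XX> s u (?P c)\<bar>"]
        by (simp add: abs_mult mult.commute del: pruned.simps trunk.simps)
    qed
    ultimately show ?thesis by linarith
  qed
  ultimately show ?case by (rule poly_growth_of_increments[OF \<delta>(1)])
qed

section \<open>Identities for \<open>\<Gamma>\<close> and compatibility with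
  \<open>\<Pi>\<close>\<close>

lemma model_Gamma_in_structure_group: "model_Gamma \<XX> s t \<in> structure_group"
  unfolding model_Gamma_def structure_group_def gamma_character_eq
  using is_character_lmap_inv[OF character_rough] by blast

lemma model_Gamma_phi: "model_Gamma \<XX> s t (basis (phi \<tau>)) = lmap phi (act_tree (\<XX> t s) \<tau>)"
proof -
  have "(\<lambda>x. gamma_character \<XX> t s (lmap Bplus_phi x)) = \<XX> t s"
    by (simp add: gamma_character_eq lmap_lmap lmap_id)
  moreover have "linear (gamma_character \<XX> t s)"
    unfolding gamma_character_eq by (rule linear_comp[OF linear_rough linear_lmap])
  ultimately show ?thesis
    using Gamma_of_phi[of "gamma_character \<XX> t s" \<tau>] character_rough by (simp add: model_Gamma_def)
qed

lemma model_Gamma_diag: "model_Gamma \<XX> s s = id"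
proof
  fix x
  show "model_Gamma \<XX> s s x = id x"
  proof (rule linear_eq_on_phi[OF linear_model_Gamma linear_id])
    fix \<tau> :: "'d ptree"
    have "act_tree (\<XX> s s) \<tau> = basis \<tau>"
      by (rule act_tree_trivial[OF character_rough rough_diag order_refl])
    then show "model_Gamma \<XX> s s (basis (phi \<tau>)) = id (basis (phi \<tau>))"
      by (simp add: model_Gamma_phi)
  qed
qed

lemma model_Gamma_comp: "model_Gamma \<XX> s t \<circ> model_Gamma \<XX> t u = model_Gamma \<XX> s u"
proof
  fix x
  show "(model_Gamma \<XX> s t \<circ> model_Gamma \<XX> t u) x = model_Gamma \<XX> s u x"
  proof (rule linear_eq_on_phi[OF linear_compose[OF linear_model_Gamma linear_model_Gamma] linear_model_Gamma])
    fix \<tau> :: "'d ptree"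
    have "model_Gamma \<XX> s t (lmap phi y) = lmap phi (lin_ext (act_tree (\<XX> t s)) y)" for y
      by (rule linear_eq_on_basis[OF linear_comp[OF linear_model_Gamma linear_lmap]
            linear_comp[OF linear_lmap linear_lin_ext]]) (simp add: model_Gamma_phi)
    then show "(model_Gamma \<XX> s t \<circ> model_Gamma \<XX> t u) (basis (phi \<tau>)) =
        model_Gamma \<XX> s u (basis (phi \<tau>))"
      by (simp add: model_Gamma_phi act_tree_comp[OF character_rough character_rough character_rough chen])
  qed
qed

lemma seminorm_bounded_model_Pi_tree: "seminorm_bounded (model_Pi_tree \<XX> s \<tau>)"
proof -
  obtain i \<omega> where "\<tau> = phi (Node i \<omega>)"
    by (metis bij_is_surj bij_phi ptree.exhaust surj_def)
  then show ?thesis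
    by (simp add: model_Pi_tree_phi seminorm_bounded_deriv seminorm_bounded_fun_distribution
        continuous_on_rough poly_growth_rough)
qed

text \<open>Chen's relation holds pointwise in \<open>t\<close> between the functions that represent
  the distributions; continuity and growth allow the finite sum to be interchanged with the integral
  against a test function.\<close>

lemma model_Pi_model_Gamma: "model_Pi \<XX> y = model_Pi \<XX> x \<circ> model_Gamma \<XX> x y"
proof (intro ext)
  fix v f
  note dist = fun_distribution_lin_ext[OF continuous_on_rough poly_growth_rough]
  show "model_Pi \<XX> y v f = (model_Pi \<XX> x \<circ> model_Gamma \<XX> x y) v f"
    unfolding comp_def
  proof (rule linear_eq_on_phi[OF linear_model_Pi linear_comp[OF linear_model_Pi linear_model_Gamma]])
    fix \<tau> :: "'d ptree"
    obtain i \<omega> where \<tau>: "\<tau> = Node i \<omega>" by (cases \<tau>)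
    let ?x = "act_forest (\<XX> y x) \<omega>"
    \<comment> \<open>The action keeps the decoration \<open>i\<close> of the root, so the same
      clause of the definition of \<open>\<Pi>\<close> applies to \<open>phi \<tau>\<close> and to
      all trees in its image.\<close>
    have rhs: "model_Pi \<XX> x (model_Gamma \<XX> x y (basis (phi \<tau>))) f =
        lin_ext (\<lambda>\<sigma>. model_Pi_tree \<XX> x (phi (Node i \<sigma>)) f) ?x"
      by (simp add: \<tau> model_Gamma_phi act_tree_Node model_Pi_eq lin_ext_lmap)
    show "model_Pi \<XX> y (basis (phi \<tau>)) f = model_Pi \<XX> x (model_Gamma \<XX> x y (basis (phi \<tau>))) f"
    proof (cases "i = 0")
      case True
      have "lin_ext (\<lambda>\<sigma>. fun_distribution (\<lambda>t. \<XX> x t (basis \<sigma>)) f) ?x =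
          fun_distribution (\<lambda>t. \<XX> y t (basis \<omega>)) f"
        unfolding dist[symmetric] chen[of y _ \<omega> x] by (simp flip: linear_eq_lin_ext[OF linear_rough])
      then show ?thesis unfolding rhs using True by (simp add: model_Pi_eq \<tau> model_Pi_tree_phi)
    next
      case False
      \<comment> \<open>The contribution of cutting the edge above the root of
        \<open>\<tau>\<close>: it occurs in Chen's relation for the forest \<open>[\<tau>]\<close>,
        but not in the coaction of \<open>phi \<tau>\<close>. It does not depend on
        \<open>t\<close>.\<close>
      let ?c = "\<XX> y x (basis [\<tau>])"
      have shift: "lin_ext (\<lambda>\<sigma>. \<XX> x t (basis [Node i \<sigma>])) ?x = \<XX> y t (basis [\<tau>]) - ?c" for t
      proof -
        have "\<XX> y t (basis [\<tau>]) = ?c + \<XX> x t (lmap (\<lambda>\<tau>. [\<tau>]) (act_tree (\<XX> y x) \<tau>))"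
          by (simp add: chen[of y t "[\<tau>]" x] act_forest_singleton[OF character_rough]
              linear_add[OF linear_rough] linear_cmul[OF linear_rough] forest_characterD(2)[OF character_rough])
        also have "\<XX> x t (lmap (\<lambda>\<tau>. [\<tau>]) (act_tree (\<XX> y x) \<tau>)) =
            lin_ext (\<lambda>\<sigma>. \<XX> x t (basis [Node i \<sigma>])) ?x"
          by (simp add: \<tau> act_tree_Node lmap_lmap linear_lmap_eq[OF linear_rough])
        finally show ?thesis by simp
      qed
      have const: "fun_distribution (\<lambda>t. \<XX> y t (basis [\<tau>]) - ?c) g =
          fun_distribution (\<lambda>t. \<XX> y t (basis [\<tau>])) g - fun_distribution (\<lambda>_. ?c) g" for g
        using integrable_mult_schwartz[OF continuous_on_rough poly_growth_rough, of y "[\<tau>]" g]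
          integrable_mult_schwartz[OF continuous_on_const poly_growth_const, of ?c g]
        by (simp add: fun_distribution_def left_diff_distrib del: integral_mult_right_zero)
      have "lin_ext (\<lambda>\<sigma>. model_Pi_tree \<XX> x (phi (Node i \<sigma>)) f) ?x =
          distribution_deriv (\<lambda>g. lin_ext (\<lambda>\<sigma>. fun_distribution (\<lambda>t. \<XX> x t (basis [Node i \<sigma>])) g) ?x) f"
        using False by (simp add: model_Pi_tree_phi distribution_deriv_def lin_ext_def sum_negf)
      also have "(\<lambda>g. lin_ext (\<lambda>\<sigma>. fun_distribution (\<lambda>t. \<XX> x t (basis [Node i \<sigma>])) g) ?x) =
          (\<lambda>g. fun_distribution (\<lambda>t. \<XX> y t (basis [\<tau>])) g - fun_distribution (\<lambda>_. ?c) g)"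
        unfolding fun_distribution_lin_ext[where H = "\<lambda>\<sigma> t. \<XX> x t (basis [Node i \<sigma>])",
            OF continuous_on_rough poly_growth_rough, symmetric] shift const ..
      also have "distribution_deriv \<dots> f =
          distribution_deriv (fun_distribution (\<lambda>t. \<XX> y t (basis [\<tau>]))) f -
          distribution_deriv (fun_distribution (\<lambda>_. ?c)) f"
        by (simp add: distribution_deriv_def)
      finally show ?thesis
        unfolding rhs using False by (simp add: model_Pi_eq \<tau> model_Pi_tree_phi distribution_deriv_const)
    qed
  qed
qed

end

theorem theorem3p7:
  fixes h :: ereal and \<gamma> :: real
    and X :: "'d::{finite,zero} \<Rightarrow> real \<Rightarrow> real"
    and \<XX> :: "real \<Rightarrow> real \<Rightarrow> ('d forest \<Rightarrow>\<^sub>0 real) \<Rightarrow> real"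
    and \<alpha> :: "'d \<Rightarrow> real"
  assumes "planarly_branched_rough_path h \<gamma> X \<XX>"
    and "\<And>i. i \<noteq> 0 \<Longrightarrow> 0 < \<alpha> i \<and> locally_holder (\<alpha> i) (X i)"
    and "\<And>\<omega> s t. \<XX> s t (basis [Node 0 \<omega>]) = (LBINT u=s..t. \<XX> s u (basis \<omega>))"
  shows "is_model (degrees \<alpha>) (homogeneous_part \<alpha>) structure_group
           (model_Pi \<XX>) (model_Gamma \<XX>)"
  unfolding is_model_def
proof (intro conjI allI)
  note rough = assms(1)
  fix x y z v f
  show "model_Gamma \<XX> x y \<in> structure_group"
    by (rule model_Gamma_in_structure_group[OF rough])
  show "model_Gamma \<XX> x x = id"
    by (rule model_Gamma_diag[OF rough])
  show "model_Gamma \<XX> x y \<circ> model_Gamma \<XX> y z = model_Gamma \<XX> x z"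
    by (rule model_Gamma_comp[OF rough])
  show "model_Pi \<XX> x v \<in> tempered_distributions"
    unfolding model_Pi_eq
    by (intro seminorm_bounded_tempered seminorm_bounded_lin_ext seminorm_bounded_model_Pi_tree[OF rough])
  show "linear (\<lambda>v. model_Pi \<XX> x v f)"
    by (rule linear_model_Pi)
  show "model_Pi \<XX> y = model_Pi \<XX> x \<circ> model_Gamma \<XX> x y"
    by (rule model_Pi_model_Gamma[OF rough])
  \<comment> \<open>Positive regularities leave only finitely many trees of each degree, as the
    continuity criterion for the direct sum demands.\<close>
  have fin: "finite {\<tau>. tree_degree \<alpha> \<tau> = a}" for a
    by (rule finite_tree_degree) (use assms(2) in blast)
  show "continuous_map (direct_sum_topology (degrees \<alpha>) (homogeneous_part \<alpha>)) strong_dual_topology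
      (model_Pi \<XX> x)"
    unfolding model_Pi_eq
    by (rule continuous_map_direct_sum_strong_dual[OF seminorm_bounded_model_Pi_tree[OF rough] fin])
      (auto simp: homogeneous_part_def)
qed

end
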